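(* Let $G=(V,E)$ be a finite simple undirected graph that is cubic (every vertex has degree $3$) and $3$-edge connected. Let $y\in\mathbb{R}^{E}$ be the vector defined by $y_e=\frac{7}{9}$ for all $e\in E$. Then $y$ is a convex combination of incidence vectors of $2$-edge connected spanning subgraphs of $G$; that is, there exist a positive integer $k$, $2$-edge connected spanning subgraphs $H_1,\dots,H_k$ of $G$, and real numbers $\lambda_1,\dots,\lambda_k\ge 0$ with $\sum_{i=1}^{k}\lambda_i=1$ such that $y=\sum_{i=1}^{k}\lambda_i\chi^{E(H_i)}$.
   Context: For $A\subset V$ with $A\neq\emptyset$ and $A\neq V$, the cut $\delta(A)$ is the set of edges of $G$ with exactly one endpoint in $A$. A graph is $k$-edge connected if every such cut has at least $k$ edges. A subgraph $H=(V_H,E_H)$ of $G$ has $V_H\subseteq V$ and $E_H\subseteq E$ (so no edge is used more than once), where $uv\in E_H$ implies $u,v\in V_H$; it is spanning if $V_H=V$. A subgraph is $2$-edge connected if it is $2$-edge connected as a graph in its own right. For a subgraph $H$ with edge set $E(H)$, the incidence vector $\chi^{E(H)}\in\mathbb{R}^{E}$ has $\chi^{E(H)}_e=1$ if $e\in E(H)$ and $\chi^{E(H)}_e=0$ otherwise. *)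

theory Defs
  imports Complex_Main "HOL-Library.Indicator_Function"
begin

type_synonym 'a ugraph = "'a set \<times> 'a set set"

abbreviation nodes :: "'a ugraph \<Rightarrow> 'a set" where
  "nodes \<equiv> fst"

abbreviation edges :: "'a ugraph \<Rightarrow> 'a set set" where
  "edges \<equiv> snd"

definition simple_graph :: "'a ugraph \<Rightarrow> bool" where
  "simple_graph G \<longleftrightarrow> finite (nodes G) \<and> (\<forall>e\<in>edges G. e \<subseteq> nodes G \<and> card e = 2)"

definition degree :: "'a ugraph \<Rightarrow> 'a \<Rightarrow> nat" where
  "degree G v = card {e \<in> edges G. v \<in> e}"

definition cubic :: "'a ugraph \<Rightarrow> bool" where
  "cubic G \<longleftrightarrow> (\<forall>v\<in>nodes G. degree G v = 3)"

definition cut :: "'a ugraph \<Rightarrow> 'a set \<Rightarrow> 'a set set" where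
  "cut G A = {e \<in> edges G. card (e \<inter> A) = 1}"

definition edge_connected :: "nat \<Rightarrow> 'a ugraph \<Rightarrow> bool" where
  "edge_connected k G \<longleftrightarrow>
     (\<forall>A. A \<subseteq> nodes G \<and> A \<noteq> {} \<and> A \<noteq> nodes G \<longrightarrow> k \<le> card (cut G A))"

definition is_subgraph :: "'a ugraph \<Rightarrow> 'a ugraph \<Rightarrow> bool" where
  "is_subgraph H G \<longleftrightarrow>
     nodes H \<subseteq> nodes G \<and> edges H \<subseteq> edges G \<and> (\<forall>e\<in>edges H. e \<subseteq> nodes H)"

definition spanning_subgraph :: "'a ugraph \<Rightarrow> 'a ugraph \<Rightarrow> bool" where
  "spanning_subgraph H G \<longleftrightarrow> is_subgraph H G \<and> nodes H = nodes G"

text \<open>Vectors indexed by the edges of a graph \<open>G\<close> are functions on \<open>'a set\<close>; only their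
  values on \<open>edges G\<close> matter, so equality of two such vectors is equality on \<open>edges G\<close>.\<close>

definition incidence_vector :: "'a ugraph \<Rightarrow> 'a set \<Rightarrow> real" where
  "incidence_vector H = indicator (edges H)"

end

(* Induction on the number of vertices.  At a nontrivial 3-edge cut one contracts either side; the
   marginals 7/9 force the trace on the cut (each edge missing with probability 2/9, none with 1/3),
   so the two distributions can be glued.

   Otherwise all 3-edge cuts are trivial.  For an edge v v' with further neighbours x1, x2 of v and
   x3, x4 of v', delete v x1 and v' x3 and suppress the four vertices of degree 2.  The result is again
   cubic and 3-edge-connected unless a 4-edge cut separates x1, x3 from x2, x4.  In the lifted
   subgraphs use every edge of the subdivided paths and neither deleted edge.  By uncrossing, one of
   the pairings 13|24 and 14|23 has no such cut, except in K_{3,3}.  Averaging over both halves of the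
   pairing, the excess over 7/9 is 2/9 on v v', -5/18 on its four neighbours and 1/9 for each endpoint
   x_i of the other edges; averaged over all v v' this is 2/9 - 4 * 5/18 + 8 * 1/9 = 0. *)

theory Submission
  imports Defs
begin

section \<open>Cut sizes\<close>

text \<open>The constant 7/9 is the fixed point of the reduction. If the smaller graph carries the
  constant r, averaging the two deletions at v v' gives the excess 1 - r on v v', 1/2 - r on each of
  the four adjacent edges, and (1 - r)/2 for each of the eight remaining incidences with some x_i;
  the total 7 - 9 r vanishes only for r = 7/9. Edges are two-element sets, so every smaller graph
  has to be simple. For a contraction this holds because the edges of a nontrivial 3-edge cut are
  pairwise disjoint. For the reduction, the absence of nontrivial 3-edge cuts excludes triangles,
  and the absence of the separating 4-edge cut excludes the other coincidences, such as parallel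
  edges after suppression. It suffices to reach at most 7/9 on every edge, because adding edges
  preserves 2-edge-connectivity; this absorbs every inequality in the counting.\<close>

definition cutsize :: "'a set set \<Rightarrow> 'a set \<Rightarrow> nat" where
  "cutsize F A = card {e \<in> F. card (e \<inter> A) = 1}"

lemma card_three: "card {a, b, c} = 3 \<Longrightarrow> a \<noteq> b \<and> a \<noteq> c \<and> b \<noteq> c"
  by (auto simp: card_insert_if split: if_splits)

lemma crosses_pair:
  "a \<noteq> b \<Longrightarrow> card ({a, b} \<inter> A) = Suc 0 \<longleftrightarrow> (a \<in> A) \<noteq> (b \<in> A)"
  by (cases "a \<in> A"; cases "b \<in> A") (auto simp: Int_insert_left)

lemma cutsize_sum:
  "finite F \<Longrightarrow> cutsize F A = (\<Sum>e\<in>F. of_bool (card (e \<inter> A) = 1))"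
  unfolding cutsize_def by (simp add: sum_of_bool_eq Int_def)

lemma cutsize_empty [simp]: "cutsize {} A = 0"
  by (simp add: cutsize_def)

lemma cutsize_empty_set [simp]: "cutsize F {} = 0"
  by (simp add: cutsize_def)

lemma cutsize_insert:
  "finite F \<Longrightarrow> e \<notin> F \<Longrightarrow> cutsize (insert e F) A = of_bool (card (e \<inter> A) = 1) + cutsize F A"
  by (simp add: cutsize_sum del: sum_of_bool_eq)

lemma cutsize_Un:
  "finite F \<Longrightarrow> finite F' \<Longrightarrow> F \<inter> F' = {} \<Longrightarrow> cutsize (F \<union> F') A = cutsize F A + cutsize F' A"
  by (simp add: cutsize_sum sum.union_disjoint del: sum_of_bool_eq)

lemma cutsize_mono: "finite F' \<Longrightarrow> F \<subseteq> F' \<Longrightarrow> cutsize F A \<le> cutsize F' A"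
  unfolding cutsize_def by (rule card_mono) auto

lemma cutsize_cong: "(\<And>e. e \<in> F \<Longrightarrow> e \<inter> A = e \<inter> B) \<Longrightarrow> cutsize F A = cutsize F B"
  unfolding cutsize_def by (rule arg_cong[where f = card]) auto

lemma cutsize_compl:
  assumes "\<And>e. e \<in> F \<Longrightarrow> e \<subseteq> V \<and> card e = 2"
  shows "cutsize F (V - A) = cutsize F A"
proof -
  have "card (e \<inter> (V - A)) = 1 \<longleftrightarrow> card (e \<inter> A) = 1" if eF: "e \<in> F" for e
  proof -
    obtain a b where e: "e = {a, b}" and ne: "a \<noteq> b"
      using assms[OF eF] by (meson card_2_iff)
    have "a \<in> V" "b \<in> V" using assms[OF eF] e by blast+
    then show ?thesis unfolding e One_nat_def crosses_pair[OF ne] by blast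
  qed
  then show ?thesis unfolding cutsize_def by (metis (no_types, lifting))
qed

lemma cutsize_singleton: "cutsize F {v} = card {e \<in> F. v \<in> e}"
proof -
  have "card (e \<inter> {v}) = 1 \<longleftrightarrow> v \<in> e" for e by (cases "v \<in> e") auto
  then show ?thesis unfolding cutsize_def by simp
qed

lemma cutsize_submodular:
  assumes "finite F" "\<And>e. e \<in> F \<Longrightarrow> card e = 2"
  shows "cutsize F (A \<inter> B) + cutsize F (A \<union> B) \<le> cutsize F A + cutsize F B"
proof -
  have "of_bool (card (e \<inter> (A \<inter> B)) = 1) + of_bool (card (e \<inter> (A \<union> B)) = 1)
      \<le> (of_bool (card (e \<inter> A) = 1) + of_bool (card (e \<inter> B) = 1) :: nat)" if eF: "e \<in> F" for e
  proof -
    obtain a b where e: "e = {a, b}" and ne: "a \<noteq> b"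
      using assms(2)[OF eF] by (meson card_2_iff)
    show ?thesis unfolding e One_nat_def crosses_pair[OF ne] by auto
  qed
  then show ?thesis
    unfolding cutsize_sum[OF assms(1)] sum.distrib[symmetric] by (rule sum_mono)
qed

section \<open>Convex combinations of indicator vectors\<close>

text \<open>The weights are indexed by the members of the family, so a numbering
  \<open>H_1, ..., H_k\<close> is needed only in the final theorem. A sum over an infinite family is
  0, hence the predicate can hold only for a finite one.\<close>

definition convex_comb :: "'b set set \<Rightarrow> 'b set \<Rightarrow> ('b \<Rightarrow> real) \<Rightarrow> bool" where
  "convex_comb \<F> E y \<longleftrightarrow> (\<exists>w. (\<forall>F\<in>\<F>. 0 \<le> w F) \<and> (\<Sum>F\<in>\<F>. w F) = 1 \<and>
     (\<forall>e\<in>E. (\<Sum>F\<in>\<F>. w F * of_bool (e \<in> F)) = y e))"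

lemma convex_comb_cong:
  "convex_comb \<F> E y \<Longrightarrow> (\<And>e. e \<in> E \<Longrightarrow> y e = z e) \<Longrightarrow> convex_comb \<F> E z"
  unfolding convex_comb_def by metis

lemma convex_comb_single:
  assumes "finite \<F>" "F \<in> \<F>"
  shows "convex_comb \<F> E (\<lambda>e. of_bool (e \<in> F))"
  unfolding convex_comb_def
  by (rule exI[where x = "\<lambda>F'. of_bool (F' = F)"])
     (use assms in \<open>auto simp: of_bool_def if_distrib[where f = "\<lambda>x. x * _"] cong: if_cong\<close>)

lemma convex_comb_sum:
  assumes "finite I" "\<And>i. i \<in> I \<Longrightarrow> 0 \<le> p i" "(\<Sum>i\<in>I. p i) = 1"
    and "\<And>i. i \<in> I \<Longrightarrow> convex_comb \<F> E (Y i)"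
  shows "convex_comb \<F> E (\<lambda>e. \<Sum>i\<in>I. p i * Y i e)"
proof -
  have "\<forall>i\<in>I. \<exists>w. (\<forall>F\<in>\<F>. 0 \<le> w F) \<and> (\<Sum>F\<in>\<F>. w F) = 1 \<and>
     (\<forall>e\<in>E. (\<Sum>F\<in>\<F>. w F * of_bool (e \<in> F)) = Y i e)"
    using assms(4) unfolding convex_comb_def by blast
  then obtain w where w: "\<And>i F. i \<in> I \<Longrightarrow> F \<in> \<F> \<Longrightarrow> 0 \<le> w i F"
    "\<And>i. i \<in> I \<Longrightarrow> (\<Sum>F\<in>\<F>. w i F) = 1"
    "\<And>i e. i \<in> I \<Longrightarrow> e \<in> E \<Longrightarrow> (\<Sum>F\<in>\<F>. w i F * of_bool (e \<in> F)) = Y i e"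
    by (auto dest!: bchoice)
  show ?thesis unfolding convex_comb_def
  proof (intro exI[where x = "\<lambda>F. \<Sum>i\<in>I. p i * w i F"] conjI ballI)
    show "0 \<le> (\<Sum>i\<in>I. p i * w i F)" if "F \<in> \<F>" for F
      by (intro sum_nonneg mult_nonneg_nonneg assms(2) w(1) that)
    have "(\<Sum>F\<in>\<F>. \<Sum>i\<in>I. p i * w i F) = (\<Sum>i\<in>I. p i * (\<Sum>F\<in>\<F>. w i F))"
      by (subst sum.swap) (simp add: sum_distrib_left)
    then show "(\<Sum>F\<in>\<F>. \<Sum>i\<in>I. p i * w i F) = 1"
      using w(2) assms(3) by simp
    fix e assume e: "e \<in> E"
    have "(\<Sum>F\<in>\<F>. (\<Sum>i\<in>I. p i * w i F) * of_bool (e \<in> F))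
        = (\<Sum>i\<in>I. p i * (\<Sum>F\<in>\<F>. w i F * of_bool (e \<in> F)))"
      unfolding sum_distrib_left sum_distrib_right mult.assoc by (rule sum.swap)
    then show "(\<Sum>F\<in>\<F>. (\<Sum>i\<in>I. p i * w i F) * of_bool (e \<in> F)) = (\<Sum>i\<in>I. p i * Y i e)"
      using w(3) e by simp
  qed
qed

lemma convex_comb_mix:
  assumes "convex_comb \<F> E y" "convex_comb \<F> E z" "0 \<le> t" "t \<le> 1"
  shows "convex_comb \<F> E (\<lambda>e. (1 - t) * y e + t * z e)"
  using convex_comb_sum[of "UNIV :: bool set" "\<lambda>b. if b then t else 1 - t" \<F> E
      "\<lambda>b. if b then z else y"] assms
  by (simp add: UNIV_bool)

text \<open>One transport principle for three uses: adding an edge, undoing a contraction, and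
  lifting from the reduced graph. In each of them a coordinate of the image either copies one
  coordinate of the source or is constant.\<close>

lemma convex_comb_map:
  assumes "convex_comb \<F>' E' y'" "finite \<F>'" "finite \<F>" "\<And>F. F \<in> \<F>' \<Longrightarrow> f F \<in> \<F>"
    and "\<And>e. e \<in> E \<Longrightarrow> (g e \<in> E' \<and> (\<forall>F\<in>\<F>'. e \<in> f F \<longleftrightarrow> g e \<in> F) \<and> y e = y' (g e))
      \<or> (\<forall>F\<in>\<F>'. e \<in> f F) \<and> y e = 1 \<or> (\<forall>F\<in>\<F>'. e \<notin> f F) \<and> y e = 0"
  shows "convex_comb \<F> E y"
proof -
  obtain w where w: "\<And>F. F \<in> \<F>' \<Longrightarrow> 0 \<le> w F" "(\<Sum>F\<in>\<F>'. w F) = 1"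
    "\<And>e. e \<in> E' \<Longrightarrow> (\<Sum>F\<in>\<F>'. w F * of_bool (e \<in> F)) = y' e"
    using assms(1) unfolding convex_comb_def by blast
  have "convex_comb \<F> E (\<lambda>e. \<Sum>F\<in>\<F>'. w F * of_bool (e \<in> f F))"
    by (rule convex_comb_sum[OF \<open>finite \<F>'\<close> w(1,2) convex_comb_single[OF \<open>finite \<F>\<close> assms(4)]])
  then show ?thesis
  proof (rule convex_comb_cong)
    fix e assume "e \<in> E"
    from assms(5)[OF this]
    consider "g e \<in> E'" "\<forall>F\<in>\<F>'. e \<in> f F \<longleftrightarrow> g e \<in> F" "y e = y' (g e)"
      | "\<forall>F\<in>\<F>'. e \<in> f F" "y e = 1" | "\<forall>F\<in>\<F>'. e \<notin> f F" "y e = 0" by blast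
    then show "(\<Sum>F\<in>\<F>'. w F * of_bool (e \<in> f F)) = y e"
    proof cases
      case 1
      then have "(\<Sum>F\<in>\<F>'. w F * of_bool (e \<in> f F)) = (\<Sum>F\<in>\<F>'. w F * of_bool (g e \<in> F))"
        by (intro sum.cong) auto
      with 1 w(3) show ?thesis by simp
    next
      case 2
      then have "(\<Sum>F\<in>\<F>'. w F * of_bool (e \<in> f F)) = (\<Sum>F\<in>\<F>'. w F)"
        by (intro sum.cong) auto
      with 2 w(2) show ?thesis by simp
    next
      case 3
      then have "(\<Sum>F\<in>\<F>'. w F * of_bool (e \<in> f F)) = (\<Sum>F\<in>\<F>'. 0)"
        by (intro sum.cong) auto
      with 3 show ?thesis by simp
    qed
  qed
qed

text \<open>Coordinates are raised one at a time. Applying \<open>insert a\<close> to every set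
  makes coordinate \<open>a\<close> equal to 1 and changes no other one; mixing this with the given
  combination reaches every value in between.\<close>

lemma convex_comb_upward:
  assumes "convex_comb \<F> E y" "finite E" "finite \<F>"
    and up: "\<And>F e. F \<in> \<F> \<Longrightarrow> e \<in> E \<Longrightarrow> insert e F \<in> \<F>"
    and z: "\<And>e. e \<in> E \<Longrightarrow> y e \<le> z e" "\<And>e. e \<in> E \<Longrightarrow> z e \<le> 1"
  shows "convex_comb \<F> E z"
proof -
  have one: "convex_comb \<F> E (u(a := 1))" if "a \<in> E" "convex_comb \<F> E u" for a u
    by (rule convex_comb_map[where f = "insert a" and g = id, OF that(2)])
       (use assms that in auto)
  have step: "convex_comb \<F> E (u(a := r))"
    if "a \<in> E" "convex_comb \<F> E u" "u a \<le> r" "r \<le> 1" for a u r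
  proof (cases "u a = 1")
    case True
    then show ?thesis using that by (auto intro: convex_comb_cong)
  next
    case False
    define t where "t = (r - u a) / (1 - u a)"
    have "t * (1 - u a) = r - u a"
      using False by (simp add: t_def)
    then have "(1 - t) * u a + t = r" by (simp add: algebra_simps)
    moreover have "0 \<le> t" "t \<le> 1" using False that by (simp_all add: t_def)
    ultimately have t: "0 \<le> t" "t \<le> 1" "(1 - t) * u a + t = r" by auto
    have "convex_comb \<F> E (\<lambda>e. (1 - t) * u e + t * (u(a := 1)) e)"
      by (intro convex_comb_mix one that t)
    then show ?thesis
      by (rule convex_comb_cong) (use t in \<open>auto simp: algebra_simps\<close>)
  qed
  have "convex_comb \<F> E (\<lambda>e. if e \<in> B then z e else y e)" if "B \<subseteq> E" for B
    using finite_subset[OF that \<open>finite E\<close>] that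
  proof (induction B rule: finite_induct)
    case empty
    then show ?case using assms(1) by simp
  next
    case (insert a B)
    have "convex_comb \<F> E ((\<lambda>e. if e \<in> B then z e else y e)(a := z a))"
      by (rule step) (use insert z in auto)
    then show ?case by (rule convex_comb_cong) auto
  qed
  from this[of E] show ?thesis by (auto intro: convex_comb_cong)
qed

section \<open>Edge sets of 2-edge-connected spanning subgraphs\<close>

definition two_ec :: "'a set \<Rightarrow> 'a set set \<Rightarrow> bool" where
  "two_ec V F \<longleftrightarrow> (\<forall>A. A \<subseteq> V \<and> A \<noteq> {} \<and> A \<noteq> V \<longrightarrow> 2 \<le> cutsize F A)"

definition two_ec_sets :: "'a set \<Rightarrow> 'a set set \<Rightarrow> 'a set set set" where
  "two_ec_sets V E = {F. F \<subseteq> E \<and> two_ec V F}"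

lemma finite_two_ec_sets: "finite E \<Longrightarrow> finite (two_ec_sets V E)"
  unfolding two_ec_sets_def by simp

lemma two_ec_sets_insert:
  assumes "finite E" "F \<in> two_ec_sets V E" "e \<in> E"
  shows "insert e F \<in> two_ec_sets V E"
proof -
  have "finite (insert e F)" using assms by (auto simp: two_ec_sets_def intro: finite_subset)
  then have "cutsize F A \<le> cutsize (insert e F) A" for A by (intro cutsize_mono) auto
  then have "2 \<le> cutsize F A \<Longrightarrow> 2 \<le> cutsize (insert e F) A" for A by (meson order_trans)
  then show ?thesis
    using assms by (simp add: two_ec_sets_def two_ec_def)
qed

lemma convex_comb_two_ec_upward:
  assumes "convex_comb (two_ec_sets V E) E y" "finite E"
    and "\<And>e. e \<in> E \<Longrightarrow> y e \<le> z e" "\<And>e. e \<in> E \<Longrightarrow> z e \<le> 1"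
  shows "convex_comb (two_ec_sets V E) E z"
  using assms(1,2) finite_two_ec_sets[OF assms(2)] two_ec_sets_insert[OF assms(2)] assms(3,4)
  by (rule convex_comb_upward)

text \<open>Every edge is missing from at least one of the three sets, so their average is at most
  2/3 < 7/9 and can be raised. In both base cases, K_4 and K_{3,3}, the sets \<open>M1\<close>,
  \<open>M2\<close>, \<open>M3\<close> are disjoint perfect matchings.\<close>

lemma convex_comb_three_factors:
  assumes "finite E" and "E - M1 \<in> two_ec_sets V E" "E - M2 \<in> two_ec_sets V E"
    "E - M3 \<in> two_ec_sets V E" and cover: "E \<subseteq> M1 \<union> M2 \<union> M3"
  shows "convex_comb (two_ec_sets V E) E (\<lambda>_. 7 / 9)"
proof -
  define M where "M i = (if i = 0 then M1 else if i = Suc 0 then M2 else M3)" for i :: nat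
  have M: "E - M i \<in> two_ec_sets V E" for i using assms by (simp add: M_def)
  have "convex_comb (two_ec_sets V E) E (\<lambda>e. \<Sum>i\<in>{0, 1, 2}. 1/3 * of_bool (e \<in> E - M i))"
    by (rule convex_comb_sum)
       (simp_all del: Diff_iff add: M convex_comb_single finite_two_ec_sets assms(1))
  then show ?thesis
    by (rule convex_comb_two_ec_upward) (use cover in \<open>auto simp: M_def assms(1)\<close>)
qed

section \<open>Cubic 3-edge-connected graphs\<close>

locale cubic_3ec =
  fixes V :: "'a set" and E :: "'a set set"
  assumes finite_V: "finite V"
    and edge: "e \<in> E \<Longrightarrow> e \<subseteq> V \<and> card e = 2"
    and deg3: "v \<in> V \<Longrightarrow> cutsize E {v} = 3"
    and conn3: "A \<subseteq> V \<Longrightarrow> A \<noteq> {} \<Longrightarrow> A \<noteq> V \<Longrightarrow> 3 \<le> cutsize E A"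
begin

lemma finite_E: "finite E"
  using edge finite_V by (intro finite_subset[of E "Pow V"]) auto

lemma edge_pair: "{u, v} \<in> E \<Longrightarrow> u \<in> V \<and> v \<in> V \<and> u \<noteq> v"
  using edge[of "{u, v}"] by (cases "u = v") auto

lemma edge_cases:
  assumes "e \<in> E"
  obtains u v where "e = {u, v}" "u \<noteq> v" "u \<in> V" "v \<in> V"
  using edge[OF assms] by (auto simp: card_2_iff)

definition nbrs :: "'a \<Rightarrow> 'a set" where
  "nbrs v = {u. {v, u} \<in> E}"

lemma nbrs_iff: "u \<in> nbrs v \<longleftrightarrow> {v, u} \<in> E"
  by (simp add: nbrs_def)

lemma nbrs_sym: "u \<in> nbrs v \<longleftrightarrow> v \<in> nbrs u"
  by (simp add: nbrs_def insert_commute)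

lemma nbrs_subset: "nbrs v \<subseteq> V"
  using edge_pair by (auto simp: nbrs_def)

lemma finite_nbrs: "finite (nbrs v)"
  using nbrs_subset finite_V finite_subset by blast

lemma not_nbrs_self: "v \<notin> nbrs v"
  using edge_pair[of v v] by (auto simp: nbrs_def)

lemma star_eq: "{e \<in> E. v \<in> e} = (\<lambda>u. {v, u}) ` nbrs v"
proof -
  have "e \<in> (\<lambda>u. {v, u}) ` nbrs v" if e: "e \<in> E" "v \<in> e" for e
  proof -
    obtain a b where "e = {a, b}" using edge_cases[OF e(1)] by metis
    then have "e = {v, a} \<or> e = {v, b}" using e(2) by auto
    then show ?thesis using e(1) by (auto simp: nbrs_def)
  qed
  then show ?thesis by (auto simp: nbrs_def)
qed

lemma inj_star: "inj_on (\<lambda>u. {v, u}) A"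
  by (auto simp: inj_on_def doubleton_eq_iff)

lemma card_nbrs: "v \<in> V \<Longrightarrow> card (nbrs v) = 3"
  using deg3[of v] by (simp add: cutsize_singleton star_eq card_image inj_star)

lemma star_cutsize: "v \<notin> A \<Longrightarrow> cutsize {e \<in> E. v \<in> e} A = card (nbrs v \<inter> A)"
proof -
  assume v: "v \<notin> A"
  have "{e \<in> {e \<in> E. v \<in> e}. card (e \<inter> A) = 1} = (\<lambda>u. {v, u}) ` (nbrs v \<inter> A)"
    unfolding star_eq using v not_nbrs_self[of v]
    by (auto simp: image_iff Int_insert_left split: if_splits)
  then show ?thesis by (simp add: cutsize_def card_image inj_star)
qed

lemma cutsize_split_star:
  "cutsize E A = cutsize {e \<in> E. v \<in> e} A + cutsize {e \<in> E. v \<notin> e} A"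
proof -
  have "E = {e \<in> E. v \<in> e} \<union> {e \<in> E. v \<notin> e}" by auto
  then show ?thesis
    using cutsize_Un[of "{e \<in> E. v \<in> e}" "{e \<in> E. v \<notin> e}" A] finite_E by auto
qed

lemma cutsize_E_compl: "cutsize E (V - A) = cutsize E A"
  using edge by (rule cutsize_compl)

text \<open>The edges from \<open>v\<close> into \<open>A\<close> leave the cut and its remaining
  edges enter it. The additive form avoids subtraction on naturals; nearly all small cuts below are
  computed by iterating it.\<close>

lemma cutsize_insert_vertex:
  assumes "v \<in> V" "v \<notin> A" "A \<subseteq> V"
  shows "cutsize E (insert v A) + 2 * card (nbrs v \<inter> A) = cutsize E A + 3"
proof -
  let ?S = "{e \<in> E. v \<in> e}" and ?R = "{e \<in> E. v \<notin> e}"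
  have "cutsize ?S (insert v A) = cutsize ?S (V - insert v A)"
    using cutsize_compl[of ?S V "insert v A"] edge by auto
  also have "\<dots> = card (nbrs v \<inter> (V - insert v A))"
    by (rule star_cutsize) auto
  also have "nbrs v \<inter> (V - insert v A) = nbrs v - nbrs v \<inter> A"
    using nbrs_subset[of v] not_nbrs_self[of v] by auto
  also have "card \<dots> = 3 - card (nbrs v \<inter> A)"
    by (simp add: card_Diff_subset finite_nbrs card_nbrs assms)
  finally have 1: "cutsize ?S (insert v A) + card (nbrs v \<inter> A) = 3"
    using card_mono[of "nbrs v" "nbrs v \<inter> A"] finite_nbrs[of v] card_nbrs[OF assms(1)] by auto
  have 2: "cutsize ?R (insert v A) = cutsize ?R A"
    by (rule cutsize_cong) auto
  show ?thesis
    using 1 2 cutsize_split_star[of A v] cutsize_split_star[of "insert v A" v]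
      star_cutsize[OF assms(2)] by linarith
qed

lemma cutsize_edge:
  assumes "{u, v} \<in> E"
  shows "cutsize E {u, v} = 4"
proof -
  have uv: "u \<in> V" "v \<in> V" "u \<noteq> v" using edge_pair[OF assms] by auto
  have "cutsize E (insert v {u}) + 2 * card (nbrs v \<inter> {u}) = cutsize E {u} + 3"
    by (rule cutsize_insert_vertex) (use uv in simp_all)
  moreover have "nbrs v \<inter> {u} = {u}"
    using assms by (auto simp: nbrs_def insert_commute)
  ultimately show ?thesis using deg3[of u] uv by (simp add: insert_commute)
qed

lemma cutsize_V [simp]: "cutsize E V = 0"
  using cutsize_E_compl[of "{}"] by simp

lemma E_in_two_ec_sets: "E \<in> two_ec_sets V E"
proof -
  have "2 \<le> cutsize E A" if "A \<subseteq> V" "A \<noteq> {}" "A \<noteq> V" for A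
    using conn3[OF that] by simp
  then show ?thesis by (simp add: two_ec_sets_def two_ec_def)
qed

text \<open>If two cut edges met in \<open>u\<close>, at most one neighbour of \<open>u\<close>
  would lie in \<open>S\<close>, and moving \<open>u\<close> out of \<open>S\<close> would leave a
  cut of at most 2 edges around a nonempty set. This keeps contractions free of parallel
  edges.\<close>

lemma cut_edges_disjoint:
  assumes S: "S \<subseteq> V" "cutsize E S = 3" "card S \<noteq> 1"
    and e: "e \<in> E" "card (e \<inter> S) = 1" "e' \<in> E" "card (e' \<inter> S) = 1" "u \<in> e" "u \<in> e'" "u \<in> S"
  shows "e = e'"
proof (rule ccontr)
  assume ne: "e \<noteq> e'"
  have u: "u \<in> V" using S e by auto
  obtain a where a: "e = {u, a}" "a \<in> nbrs u" using star_eq[of u] e by auto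
  obtain b where b: "e' = {u, b}" "b \<in> nbrs u" using star_eq[of u] e by auto
  have ab: "a \<noteq> b" "a \<noteq> u" "b \<noteq> u" "a \<notin> S" "b \<notin> S"
    using ne a b e not_nbrs_self[of u] by (auto simp: crosses_pair)
  have "nbrs u \<inter> (S - {u}) \<subseteq> nbrs u - {a, b}" using ab by auto
  then have "card (nbrs u \<inter> (S - {u})) \<le> card (nbrs u - {a, b})"
    by (intro card_mono) (auto simp: finite_nbrs)
  also have "\<dots> = 1" using ab a b card_nbrs[OF u] by (simp add: card_Diff_subset)
  finally have "card (nbrs u \<inter> (S - {u})) \<le> 1" .
  moreover have "cutsize E (insert u (S - {u})) + 2 * card (nbrs u \<inter> (S - {u}))
      = cutsize E (S - {u}) + 3"
    by (rule cutsize_insert_vertex) (use S u in auto)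
  moreover have "insert u (S - {u}) = S" using e by auto
  ultimately have "cutsize E (S - {u}) \<le> 2" using S by simp
  moreover have "S - {u} \<noteq> {}"
    using S(3) e(7) by (metis insert_Diff is_singletonI is_singleton_altdef)
  moreover have "S - {u} \<noteq> V" using u by auto
  ultimately show False using conn3[of "S - {u}"] S by auto
qed

end

section \<open>Gluing over 3-edge cuts\<close>

text \<open>At most one element of \<open>C\<close> is missing, so the indicator of a trace is
  affine in the membership indicators: the full trace is \<open>card (F \<inter> C) - 2\<close>,
  with expectation 3 * 7/9 - 2 = 1/3, and a trace missing \<open>c\<close> is
  \<open>1 - of_bool (c \<in> F)\<close>, with expectation 2/9.\<close>

lemma pattern_weight:
  assumes fin: "finite \<F>" and C: "card C = 3" "P \<subseteq> C" "2 \<le> card P"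
    and two: "\<And>F. F \<in> \<F> \<Longrightarrow> 2 \<le> card (F \<inter> C)"
    and w: "(\<Sum>F\<in>\<F>. w F) = 1" "\<And>c. c \<in> C \<Longrightarrow> (\<Sum>F\<in>\<F>. w F * of_bool (c \<in> F)) = (7/9 :: real)"
  shows "(\<Sum>F\<in>{F \<in> \<F>. F \<inter> C = P}. w F) = (if P = C then 1/3 else 2/9)"
proof -
  have finC: "finite C" using C by (metis card.infinite zero_neq_numeral)
  have eq: "(\<Sum>F\<in>{F \<in> \<F>. F \<inter> C = P}. w F) = (\<Sum>F\<in>\<F>. w F * of_bool (F \<inter> C = P))"
    using fin by (simp add: Int_def)
  have bound: "card (F \<inter> C) = 2 \<or> card (F \<inter> C) = 3" if "F \<in> \<F>" for F
    using two[OF that] card_mono[OF finC, of "F \<inter> C"] C by auto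
  show ?thesis
  proof (cases "P = C")
    case True
    have "of_bool (F \<inter> C = P) = (\<Sum>c\<in>C. of_bool (c \<in> F)) - (2::real)" if "F \<in> \<F>" for F
    proof -
      have "(\<Sum>c\<in>C. of_bool (c \<in> F)) = real (card (F \<inter> C))"
        using finC by (simp add: Int_commute Int_def conj_commute)
      moreover have "F \<inter> C = C \<longleftrightarrow> card (F \<inter> C) = 3"
        using C finC by (metis card_subset_eq inf_le2)
      ultimately show ?thesis using bound[OF that] True by auto
    qed
    then have "(\<Sum>F\<in>\<F>. w F * of_bool (F \<inter> C = P))
        = (\<Sum>F\<in>\<F>. w F * ((\<Sum>c\<in>C. of_bool (c \<in> F)) - 2))"
      by (intro sum.cong) auto
    also have "\<dots> = (\<Sum>F\<in>\<F>. \<Sum>c\<in>C. w F * of_bool (c \<in> F)) - (\<Sum>F\<in>\<F>. w F * 2)"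
      unfolding right_diff_distrib sum_subtractf sum_distrib_left ..
    also have "(\<Sum>F\<in>\<F>. \<Sum>c\<in>C. w F * of_bool (c \<in> F)) = (\<Sum>c\<in>C. \<Sum>F\<in>\<F>. w F * of_bool (c \<in> F))"
      by (rule sum.swap)
    also have "\<dots> = (\<Sum>c\<in>C. 7/9)" by (rule sum.cong[OF refl w(2)])
    also have "(\<Sum>F\<in>\<F>. w F * 2) = 2" using w(1) by (simp flip: sum_distrib_right)
    finally show ?thesis using True C eq by simp
  next
    case False
    then have "card P < 3" using C finC psubset_card_mono[of C P] by auto
    then have "card (C - P) = 1" using C finC card_Diff_subset[of P C] finite_subset[of P C] by auto
    then obtain c where c: "C - P = {c}" by (meson card_1_singletonE)
    have "of_bool (F \<inter> C = P) = 1 - (of_bool (c \<in> F) :: real)" if F: "F \<in> \<F>" for F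
    proof -
      have "F \<inter> C = P" if "c \<notin> F"
      proof -
        have "F \<inter> C \<subseteq> P" using that c by auto
        moreover have "card P \<le> card (F \<inter> C)" using two[OF F] \<open>card P < 3\<close> by auto
        ultimately show ?thesis using C(2) finC by (intro card_seteq) (auto intro: finite_subset)
      qed
      moreover have "F \<inter> C \<noteq> P" if "c \<in> F" using that c by auto
      ultimately show ?thesis by auto
    qed
    then have "(\<Sum>F\<in>\<F>. w F * of_bool (F \<inter> C = P)) = (\<Sum>F\<in>\<F>. w F * (1 - of_bool (c \<in> F)))"
      by (intro sum.cong) auto
    also have "\<dots> = (\<Sum>F\<in>\<F>. w F) - (\<Sum>F\<in>\<F>. w F * of_bool (c \<in> F))"
      unfolding right_diff_distrib sum_subtractf by simp
    also have "\<dots> = 1 - 7/9" using w c by auto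
    finally show ?thesis using False eq by simp
  qed
qed

text \<open>Integrates out the second component: for fixed \<open>F\<close>, the numbers
  \<open>w2 F' / q (F \<inter> C)\<close> are a probability distribution on the sets with the same
  trace. Used for both marginals of the glued distribution.\<close>

lemma sum_conditional:
  fixes w1 w2 q :: "_ \<Rightarrow> real"
  assumes "\<And>F. F \<in> \<F> \<Longrightarrow> (\<Sum>F'\<in>{F' \<in> \<F>'. F' \<inter> C = F \<inter> C}. w2 F') = q (F \<inter> C)"
    and "\<And>F. F \<in> \<F> \<Longrightarrow> q (F \<inter> C) \<noteq> 0"
  shows "(\<Sum>F\<in>\<F>. \<Sum>F'\<in>{F' \<in> \<F>'. F' \<inter> C = F \<inter> C}. w1 F * w2 F' / q (F \<inter> C) * h F)
    = (\<Sum>F\<in>\<F>. w1 F * h F)"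
proof (rule sum.cong[OF refl])
  fix F assume F: "F \<in> \<F>"
  have "(\<Sum>F'\<in>{F' \<in> \<F>'. F' \<inter> C = F \<inter> C}. w1 F * w2 F' / q (F \<inter> C) * h F)
      = (w1 F / q (F \<inter> C) * h F) * (\<Sum>F'\<in>{F' \<in> \<F>'. F' \<inter> C = F \<inter> C}. w2 F')"
    unfolding sum_distrib_left by (simp add: ac_simps)
  also have "\<dots> = w1 F * h F" using assms[OF F] by simp
  finally show "(\<Sum>F'\<in>{F' \<in> \<F>'. F' \<inter> C = F \<inter> C}. w1 F * w2 F' / q (F \<inter> C) * h F) = w1 F * h F" .
qed

text \<open>On a 3-element overlap \<open>C\<close> of which every set contains at least two elements, the marginals
  \<open>7/9\<close> determine the distribution of the trace on \<open>C\<close>, so the two distributions can be joined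
  conditionally on the trace.\<close>

lemma convex_comb_glue:
  assumes fin: "finite \<F>1" "finite \<F>2" "finite \<F>"
    and C: "C = E1 \<inter> E2" "card C = 3"
    and sub: "\<And>F. F \<in> \<F>1 \<Longrightarrow> F \<subseteq> E1" "\<And>F. F \<in> \<F>2 \<Longrightarrow> F \<subseteq> E2"
    and two: "\<And>F. F \<in> \<F>1 \<Longrightarrow> 2 \<le> card (F \<inter> C)" "\<And>F. F \<in> \<F>2 \<Longrightarrow> 2 \<le> card (F \<inter> C)"
    and cc: "convex_comb \<F>1 E1 (\<lambda>_. 7 / 9)" "convex_comb \<F>2 E2 (\<lambda>_. 7 / 9)"
    and join: "\<And>F1 F2. F1 \<in> \<F>1 \<Longrightarrow> F2 \<in> \<F>2 \<Longrightarrow> F1 \<inter> C = F2 \<inter> C \<Longrightarrow> F1 \<union> F2 \<in> \<F>"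
  shows "convex_comb \<F> (E1 \<union> E2) (\<lambda>_. 7 / 9)"
proof -
  obtain w1 where w1: "\<And>F. F \<in> \<F>1 \<Longrightarrow> 0 \<le> w1 F" "(\<Sum>F\<in>\<F>1. w1 F) = 1"
    "\<And>e. e \<in> E1 \<Longrightarrow> (\<Sum>F\<in>\<F>1. w1 F * of_bool (e \<in> F)) = (7/9 :: real)"
    using cc(1) unfolding convex_comb_def by blast
  obtain w2 where w2: "\<And>F. F \<in> \<F>2 \<Longrightarrow> 0 \<le> w2 F" "(\<Sum>F\<in>\<F>2. w2 F) = 1"
    "\<And>e. e \<in> E2 \<Longrightarrow> (\<Sum>F\<in>\<F>2. w2 F * of_bool (e \<in> F)) = (7/9 :: real)"
    using cc(2) unfolding convex_comb_def by blast
  define q :: "_ \<Rightarrow> real" where "q P = (if P = C then 1/3 else 2/9)" for P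
  define I where "I = (SIGMA F1:\<F>1. {F2 \<in> \<F>2. F2 \<inter> C = F1 \<inter> C})"
  define p where "p = (\<lambda>(F1, F2). w1 F1 * w2 F2 / q (F1 \<inter> C))"
  have q: "q P > 0" for P by (simp add: q_def)
  have q1: "(\<Sum>F'\<in>{F' \<in> \<F>1. F' \<inter> C = F \<inter> C}. w1 F') = q (F \<inter> C)" if "F \<in> \<F>2" for F
    unfolding q_def by (rule pattern_weight) (use that fin C two w1 in auto)
  have q2: "(\<Sum>F'\<in>{F' \<in> \<F>2. F' \<inter> C = F \<inter> C}. w2 F') = q (F \<inter> C)" if "F \<in> \<F>1" for F
    unfolding q_def by (rule pattern_weight) (use that fin C two w2 in auto)
  have sum1: "(\<Sum>i\<in>I. p i * h (fst i)) = (\<Sum>F\<in>\<F>1. w1 F * h F)" for h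
  proof -
    have "(\<Sum>i\<in>I. p i * h (fst i))
        = (\<Sum>F\<in>\<F>1. \<Sum>F'\<in>{F' \<in> \<F>2. F' \<inter> C = F \<inter> C}. w1 F * w2 F' / q (F \<inter> C) * h F)"
      unfolding I_def p_def by (subst sum.Sigma) (use fin in \<open>auto intro: sum.cong\<close>)
    also have "\<dots> = (\<Sum>F\<in>\<F>1. w1 F * h F)"
      by (rule sum_conditional) (use q2 q in \<open>auto simp: less_imp_neq[symmetric]\<close>)
    finally show ?thesis .
  qed
  have sum2: "(\<Sum>i\<in>I. p i * h (snd i)) = (\<Sum>F\<in>\<F>2. w2 F * h F)" for h
  proof -
    have "(\<Sum>i\<in>I. p i * h (snd i))
        = (\<Sum>F\<in>\<F>1. \<Sum>F'\<in>{F' \<in> \<F>2. F' \<inter> C = F \<inter> C}. w1 F * w2 F' / q (F \<inter> C) * h F')"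
      unfolding I_def p_def by (subst sum.Sigma) (use fin in \<open>auto intro: sum.cong\<close>)
    also have "\<dots> = (\<Sum>F'\<in>\<F>2. \<Sum>F\<in>{F \<in> \<F>1. F' \<inter> C = F \<inter> C}. w1 F * w2 F' / q (F \<inter> C) * h F')"
      by (rule sum.swap_restrict) (use fin in auto)
    also have "\<dots> = (\<Sum>F'\<in>\<F>2. \<Sum>F\<in>{F \<in> \<F>1. F \<inter> C = F' \<inter> C}. w2 F' * w1 F / q (F' \<inter> C) * h F')"
      by (intro sum.cong) auto
    also have "\<dots> = (\<Sum>F\<in>\<F>2. w2 F * h F)"
      by (rule sum_conditional) (use q1 q in \<open>auto simp: less_imp_neq[symmetric]\<close>)
    finally show ?thesis .
  qed
  have "convex_comb \<F> (E1 \<union> E2) (\<lambda>e. \<Sum>i\<in>I. p i * of_bool (e \<in> fst i \<union> snd i))"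
  proof (rule convex_comb_sum)
    show "finite I" unfolding I_def using fin by auto
    show "0 \<le> p i" if "i \<in> I" for i
      using that w1(1) w2(1) q unfolding I_def p_def by (auto simp: less_imp_le)
    show "(\<Sum>i\<in>I. p i) = 1" using sum1[of "\<lambda>_. 1"] w1(2) by simp
    show "convex_comb \<F> (E1 \<union> E2) (\<lambda>e. of_bool (e \<in> fst i \<union> snd i))" if "i \<in> I" for i
      by (rule convex_comb_single) (use fin join that in \<open>auto simp: I_def\<close>)
  qed
  then show ?thesis
  proof (rule convex_comb_cong)
    fix e assume e: "e \<in> E1 \<union> E2"
    show "(\<Sum>i\<in>I. p i * of_bool (e \<in> fst i \<union> snd i)) = 7 / 9"
    proof (cases "e \<in> E1")
      case True
      \<comment> \<open>If \<open>e\<close> also lies in \<open>snd i\<close>, then it belongs to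
        \<open>C\<close>, where the two components agree.\<close>
      have "e \<in> fst i \<union> snd i \<longleftrightarrow> e \<in> fst i" if "i \<in> I" for i
      proof -
        have "snd i \<in> \<F>2" "snd i \<inter> C = fst i \<inter> C" using that unfolding I_def by auto
        then show ?thesis using True C(1) sub(2)[of "snd i"] by auto
      qed
      then have "(\<Sum>i\<in>I. p i * of_bool (e \<in> fst i \<union> snd i)) = (\<Sum>i\<in>I. p i * of_bool (e \<in> fst i))"
        by (intro sum.cong) auto
      then show ?thesis using sum1[of "\<lambda>F. of_bool (e \<in> F)"] w1(3)[OF True] by simp
    next
      case False
      have "e \<in> fst i \<union> snd i \<longleftrightarrow> e \<in> snd i" if "i \<in> I" for i
        using that False sub(1)[of "fst i"] unfolding I_def by auto
      then have "(\<Sum>i\<in>I. p i * of_bool (e \<in> fst i \<union> snd i)) = (\<Sum>i\<in>I. p i * of_bool (e \<in> snd i))"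
        by (intro sum.cong) auto
      then show ?thesis using sum2[of "\<lambda>F. of_bool (e \<in> F)"] w2(3)[of e] e False by simp
    qed
  qed
qed

text \<open>\<open>half E S\<close> consists of the traces, on the edges meeting \<open>S\<close>, of 2-edge-connected spanning
  subgraphs of the graph obtained by contracting the complement of \<open>S\<close>.\<close>

definition half :: "'a set set \<Rightarrow> 'a set \<Rightarrow> 'a set set set" where
  "half E S = {F. F \<subseteq> {e \<in> E. e \<inter> S \<noteq> {}} \<and> (\<forall>X. X \<subseteq> S \<and> X \<noteq> {} \<longrightarrow> 2 \<le> cutsize F X)}"

section \<open>Contracting one side of a 3-edge cut and joining the two halves\<close>

context cubic_3ec
begin

text \<open>The new vertex \<open>z\<close> stands for the contracted complement of
  \<open>S\<close>. The map \<open>\<phi>\<close> redirects the outer end of each cut edge to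
  \<open>z\<close>; it is injective because cut edges have distinct ends in \<open>S\<close>. Cuts
  of sets avoiding \<open>z\<close> are unchanged, and any other set is replaced by its
  complement.\<close>

lemma contract:
  assumes S: "S \<subseteq> V" "cutsize E S = 3" "card S \<noteq> 1" and z: "z \<notin> S"
  shows "\<exists>E1. cubic_3ec (insert z S) E1 \<and>
    (convex_comb (two_ec_sets (insert z S) E1) E1 (\<lambda>_. 7 / 9) \<longrightarrow>
     convex_comb (half E S) {e \<in> E. e \<inter> S \<noteq> {}} (\<lambda>_. 7 / 9))"
proof -
  define ES where "ES = {e \<in> E. e \<inter> S \<noteq> {}}"
  define \<phi> where "\<phi> e = (if e \<subseteq> S then e else insert z (e \<inter> S))" for e
  have finES: "finite ES" unfolding ES_def using finite_E by simp
  have cross: "e \<subseteq> S \<or> card (e \<inter> S) = 1" if eE: "e \<in> ES" for e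
  proof -
    have "e \<in> E" using eE by (simp add: ES_def)
    then obtain a b where "e = {a, b}" "a \<noteq> b" using edge_cases by metis
    then show ?thesis using eE by (auto simp: ES_def Int_insert_left)
  qed
  have z\<phi>: "z \<in> \<phi> e \<longleftrightarrow> \<not> e \<subseteq> S" for e unfolding \<phi>_def using z by auto
  have \<phi>_Int: "\<phi> e \<inter> X = e \<inter> X" if "X \<subseteq> S" for e X
    unfolding \<phi>_def using z that by auto
  have inj: "inj_on \<phi> ES"
  proof (rule inj_onI)
    fix e e' assume e: "e \<in> ES" "e' \<in> ES" "\<phi> e = \<phi> e'"
    have sub: "e \<subseteq> S \<longleftrightarrow> e' \<subseteq> S" using z\<phi> e(3) by metis
    show "e = e'"
    proof (cases "e \<subseteq> S")
      case True
      then show ?thesis using sub e(3) by (simp add: \<phi>_def)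
    next
      case False
      have "e \<inter> S = e' \<inter> S" using \<phi>_Int[of S e] \<phi>_Int[of S e'] e(3) by simp
      then obtain u where "u \<in> e" "u \<in> e'" "u \<in> S" using e(1) by (auto simp: ES_def)
      moreover have "card (e \<inter> S) = 1" "card (e' \<inter> S) = 1"
        using cross e False sub by auto
      moreover have "e \<in> E" "e' \<in> E" using e by (auto simp: ES_def)
      ultimately show ?thesis using cut_edges_disjoint[OF S] by blast
    qed
  qed
  have cs: "cutsize (\<phi> ` F) X = cutsize F X" if "F \<subseteq> ES" "X \<subseteq> S" for F X
  proof -
    have "{e \<in> \<phi> ` F. card (e \<inter> X) = 1} = \<phi> ` {e \<in> F. card (e \<inter> X) = 1}"
      using \<phi>_Int[OF that(2)] by auto
    moreover have "inj_on \<phi> {e \<in> F. card (e \<inter> X) = 1}"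
      using inj that(1) by (auto intro: inj_on_subset)
    ultimately show ?thesis by (simp add: cutsize_def card_image)
  qed
  have csE: "cutsize ES X = cutsize E X" if "X \<subseteq> S" for X
  proof -
    have "e \<inter> S \<noteq> {}" if e: "card (e \<inter> X) = 1" for e
    proof -
      obtain x where "e \<inter> X = {x}" using e by (meson card_1_singletonE)
      then show ?thesis using \<open>X \<subseteq> S\<close> by auto
    qed
    then have "{e \<in> ES. card (e \<inter> X) = 1} = {e \<in> E. card (e \<inter> X) = 1}"
      unfolding ES_def by blast
    then show ?thesis by (simp add: cutsize_def)
  qed
  have cs1: "cutsize (\<phi> ` ES) X = cutsize E X" if "X \<subseteq> S" for X
    using cs[OF order_refl that] csE[OF that] by simp
  have edge1: "e \<subseteq> insert z S \<and> card e = 2" if e: "e \<in> \<phi> ` ES" for e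
  proof -
    obtain d where d: "e = \<phi> d" "d \<in> ES" using e by auto
    have "finite (d \<inter> S)" using S(1) finite_V by (auto intro: finite_subset)
    then show ?thesis using cross[OF d(2)] edge[of d] d z by (auto simp: \<phi>_def ES_def)
  qed
  have compl1: "cutsize (\<phi> ` ES) (insert z S - X) = cutsize (\<phi> ` ES) X" for X
    by (rule cutsize_compl) (rule edge1)
  have "S \<noteq> {}" "S \<noteq> V" using S(2) by auto
  have cubic1: "cubic_3ec (insert z S) (\<phi> ` ES)"
  proof
    show "finite (insert z S)" using S(1) finite_V by (auto intro: finite_subset)
    show "e \<in> \<phi> ` ES \<Longrightarrow> e \<subseteq> insert z S \<and> card e = 2" for e by (rule edge1)
    show "cutsize (\<phi> ` ES) {v} = 3" if v: "v \<in> insert z S" for v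
    proof (cases "v = z")
      case True
      then have "{v} = insert z S - S" using z by auto
      then show ?thesis using compl1[of S] cs1[of S] S(2) by simp
    next
      case False
      then show ?thesis using v cs1[of "{v}"] deg3[of v] S(1) by auto
    qed
    show "3 \<le> cutsize (\<phi> ` ES) A" if A: "A \<subseteq> insert z S" "A \<noteq> {}" "A \<noteq> insert z S" for A
    proof -
      define B where "B = (if z \<in> A then insert z S - A else A)"
      have B: "B \<subseteq> S" "B \<noteq> {}" using A by (auto simp: B_def)
      have "cutsize (\<phi> ` ES) A = cutsize (\<phi> ` ES) B"
        unfolding B_def if_distrib[where f = "cutsize _"] compl1 by simp
      also have "\<dots> = cutsize E B" by (rule cs1) (rule B)
      finally show ?thesis using conn3[of B] B S(1) \<open>S \<noteq> V\<close> by auto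
    qed
  qed
  have "convex_comb (half E S) ES (\<lambda>_. 7 / 9)"
    if cc: "convex_comb (two_ec_sets (insert z S) (\<phi> ` ES)) (\<phi> ` ES) (\<lambda>_. 7 / 9)"
  proof (rule convex_comb_map[OF cc, where f = "\<lambda>F. {e \<in> ES. \<phi> e \<in> F}" and g = \<phi>])
    show "finite (two_ec_sets (insert z S) (\<phi> ` ES))"
      using finES by (simp add: finite_two_ec_sets)
    show "finite (half E S)" unfolding half_def using finES by (simp add: ES_def)
    show "{e \<in> ES. \<phi> e \<in> F} \<in> half E S" if F: "F \<in> two_ec_sets (insert z S) (\<phi> ` ES)" for F
    proof -
      have "F = \<phi> ` {e \<in> ES. \<phi> e \<in> F}" using F by (auto simp: two_ec_sets_def)
      then have eq: "cutsize {e \<in> ES. \<phi> e \<in> F} X = cutsize F X" if "X \<subseteq> S" for X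
        using cs[of "{e \<in> ES. \<phi> e \<in> F}" X] that by simp
      have "2 \<le> cutsize F X" if X: "X \<subseteq> S" "X \<noteq> {}" for X
      proof -
        have "X \<subseteq> insert z S" "X \<noteq> insert z S" using X z by auto
        then show ?thesis using F X(2) by (simp add: two_ec_sets_def two_ec_def)
      qed
      then show ?thesis using eq by (auto simp: half_def ES_def)
    qed
  qed simp
  then show ?thesis using cubic1 unfolding ES_def by blast
qed

text \<open>A cut edge of \<open>S\<close> has its inner end in only one of \<open>X\<close> and
  \<open>S - X\<close>, so these two sets together are crossed by at most 3 cut edges, while
  \<open>F\<close> crosses each of them at least twice. The difference must come from inner edges,
  which cross both sets alike.\<close>

lemma half_inner:
  assumes S: "S \<subseteq> V" "cutsize E S = 3" and F: "F \<in> half E S"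
    and X: "X \<subseteq> S" "X \<noteq> {}" "X \<noteq> S"
  shows "1 \<le> cutsize (F - {e \<in> E. card (e \<inter> S) = 1}) X"
proof -
  let ?C = "{e \<in> E. card (e \<inter> S) = 1}"
  have FE: "F \<subseteq> E" using F by (auto simp: half_def)
  have finF: "finite F" using FE finite_E by (rule finite_subset)
  have split: "cutsize F A = cutsize (F - ?C) A + cutsize (F \<inter> ?C) A" for A
  proof -
    have "(F - ?C) \<inter> (F \<inter> ?C) = {}" by blast
    then show ?thesis using cutsize_Un[of "F - ?C" "F \<inter> ?C" A] finF by (simp add: Un_Diff_Int)
  qed
  have "e \<subseteq> S \<and> card e = 2" if e: "e \<in> F - ?C" for e
  proof -
    have eE: "e \<in> E" "e \<inter> S \<noteq> {}" "card (e \<inter> S) \<noteq> 1" using e F by (auto simp: half_def)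
    obtain a b where ab: "e = {a, b}" "a \<noteq> b" using edge_cases[OF eE(1)] by metis
    then show ?thesis using eE by (auto simp: crosses_pair)
  qed
  then have "cutsize (F - ?C) (S - X) = cutsize (F - ?C) X" by (rule cutsize_compl)
  moreover have "cutsize (F \<inter> ?C) X + cutsize (F \<inter> ?C) (S - X) \<le> 3"
  proof -
    have "{e \<in> F \<inter> ?C. card (e \<inter> X) = 1} \<inter> {e \<in> F \<inter> ?C. card (e \<inter> (S - X)) = 1} = {}"
    proof -
      have False if c: "card (e \<inter> X) = 1" "card (e \<inter> (S - X)) = 1" "card (e \<inter> S) = 1" for e
      proof -
        obtain u where u: "e \<inter> S = {u}" using c(3) by (meson card_1_singletonE)
        obtain x where "e \<inter> X = {x}" using c(1) by (meson card_1_singletonE)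
        then have x: "x \<in> e" "x \<in> X" by auto
        obtain y where "e \<inter> (S - X) = {y}" using c(2) by (meson card_1_singletonE)
        then have y: "y \<in> e" "y \<in> S" "y \<notin> X" by auto
        have "x \<in> {u}" "y \<in> {u}" unfolding u[symmetric] using x y X(1) by auto
        then show False using x y by auto
      qed
      then show ?thesis by blast
    qed
    then have "cutsize (F \<inter> ?C) X + cutsize (F \<inter> ?C) (S - X)
       = card ({e \<in> F \<inter> ?C. card (e \<inter> X) = 1} \<union> {e \<in> F \<inter> ?C. card (e \<inter> (S - X)) = 1})"
      unfolding cutsize_def using finF by (subst card_Un_disjoint) auto
    also have "\<dots> \<le> card ?C" by (rule card_mono) (use finite_E in auto)
    finally show ?thesis using S(2) by (simp add: cutsize_def)
  qed
  moreover have "2 \<le> cutsize F X" "2 \<le> cutsize F (S - X)"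
    using F X unfolding half_def by auto
  ultimately show ?thesis using split[of X] split[of "S - X"] by linarith
qed

text \<open>If \<open>X\<close> or its complement lies within one side, the half belonging to that
  side already crosses twice. Otherwise \<open>X\<close> splits both sides, and each half
  contributes one inner edge by \<open>half_inner\<close>.\<close>

lemma glue_two_ec:
  assumes S: "S \<subseteq> V" "cutsize E S = 3" and F1: "F1 \<in> half E S" and F2: "F2 \<in> half E (V - S)"
  shows "F1 \<union> F2 \<in> two_ec_sets V E"
proof -
  let ?C = "{e \<in> E. card (e \<inter> S) = 1}" and ?F = "F1 \<union> F2"
  have FE: "F1 \<subseteq> E" "F2 \<subseteq> E" using F1 F2 by (auto simp: half_def)
  have fin: "finite ?F" using FE finite_E by (simp add: finite_subset)
  have compl: "cutsize ?F (V - X) = cutsize ?F X" for X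
    by (rule cutsize_compl) (use FE edge in auto)
  have S': "cutsize E (V - S) = 3" using cutsize_E_compl[of S] S by simp
  have "2 \<le> cutsize ?F X" if X: "X \<subseteq> V" "X \<noteq> {}" "X \<noteq> V" for X
  proof -
    have one: "2 \<le> cutsize ?F Y" if "Y \<subseteq> S \<or> Y \<subseteq> V - S" "Y \<noteq> {}" for Y
    proof -
      have "2 \<le> cutsize F1 Y \<or> 2 \<le> cutsize F2 Y" using that F1 F2 by (auto simp: half_def)
      then show ?thesis using cutsize_mono[OF fin, of F1 Y] cutsize_mono[OF fin, of F2 Y] by auto
    qed
    consider "X \<subseteq> S" | "X \<subseteq> V - S" | "V - X \<subseteq> S" | "V - X \<subseteq> V - S"
      | "X \<inter> S \<noteq> {}" "X \<inter> S \<noteq> S" "X - S \<noteq> {}" "X - S \<noteq> V - S"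
      using X(1) by blast
    then show ?thesis
    proof cases
      case 5
      have cr: "{e \<in> E. card (e \<inter> (V - S)) = 1} = ?C"
      proof -
        have "card (e \<inter> (V - S)) = 1 \<longleftrightarrow> card (e \<inter> S) = 1" if "e \<in> E" for e
        proof -
          obtain a b where e: "e = {a, b}" and ab: "a \<noteq> b" "a \<in> V" "b \<in> V"
            using edge_cases[OF \<open>e \<in> E\<close>] by metis
          show ?thesis unfolding e One_nat_def crosses_pair[OF ab(1)] using ab by blast
        qed
        then show ?thesis by blast
      qed
      have 1: "1 \<le> cutsize (F1 - ?C) (X \<inter> S)"
        by (rule half_inner) (use S F1 5 in auto)
      have "1 \<le> cutsize (F2 - {e \<in> E. card (e \<inter> (V - S)) = 1}) (X - S)"
        by (rule half_inner) (use S' F2 5 X in auto)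
      then have 2: "1 \<le> cutsize (F2 - ?C) (X - S)" unfolding cr .
      have inS: "e \<subseteq> S" if "e \<in> F1 - ?C" for e
      proof -
        have e: "e \<in> E" "e \<inter> S \<noteq> {}" "card (e \<inter> S) \<noteq> 1" using that F1 by (auto simp: half_def)
        obtain a b where ab: "e = {a, b}" "a \<noteq> b" using edge_cases[OF e(1)] by metis
        then show ?thesis using e by (auto simp: crosses_pair)
      qed
      have inS': "e \<subseteq> V - S" if "e \<in> F2 - ?C" for e
      proof -
        have e: "e \<in> E" "e \<inter> (V - S) \<noteq> {}" "card (e \<inter> S) \<noteq> 1"
          using that F2 by (auto simp: half_def)
        obtain a b where ab: "e = {a, b}" "a \<noteq> b" "a \<in> V" "b \<in> V" using edge_cases[OF e(1)] .
        then show ?thesis using e by (auto simp: crosses_pair)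
      qed
      have "cutsize (F1 - ?C) X = cutsize (F1 - ?C) (X \<inter> S)"
        by (rule cutsize_cong) (use inS in blast)
      moreover have "cutsize (F2 - ?C) X = cutsize (F2 - ?C) (X - S)"
        by (rule cutsize_cong) (use inS' in blast)
      moreover have "(F1 - ?C) \<inter> (F2 - ?C) = {}"
      proof -
        have False if e: "e \<in> F1 - ?C" "e \<in> F2 - ?C" for e
        proof -
          have "e = {}" using inS[OF e(1)] inS'[OF e(2)] by auto
          then show False using edge[of e] e FE by auto
        qed
        then show ?thesis by blast
      qed
      then have "cutsize ((F1 - ?C) \<union> (F2 - ?C)) X = cutsize (F1 - ?C) X + cutsize (F2 - ?C) X"
        by (intro cutsize_Un) (use fin in auto)
      moreover have "cutsize ((F1 - ?C) \<union> (F2 - ?C)) X \<le> cutsize ?F X"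
        by (rule cutsize_mono) (use fin in auto)
      ultimately show ?thesis using 1 2 by linarith
    qed (use one[of X] one[of "V - X"] compl[of X] X in auto)
  qed
  then show ?thesis using FE by (simp add: two_ec_sets_def two_ec_def)
qed

lemma glue:
  assumes S: "S \<subseteq> V" "cutsize E S = 3"
    and cc: "convex_comb (half E S) {e \<in> E. e \<inter> S \<noteq> {}} (\<lambda>_. 7 / 9)"
      "convex_comb (half E (V - S)) {e \<in> E. e \<inter> (V - S) \<noteq> {}} (\<lambda>_. 7 / 9)"
  shows "convex_comb (two_ec_sets V E) E (\<lambda>_. 7 / 9)"
proof -
  let ?C = "{e \<in> E. card (e \<inter> S) = 1}"
  let ?E1 = "{e \<in> E. e \<inter> S \<noteq> {}}" and ?E2 = "{e \<in> E. e \<inter> (V - S) \<noteq> {}}"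
  have C: "e \<in> ?E1 \<inter> ?E2 \<longleftrightarrow> e \<in> ?C" "e \<in> ?E1 \<union> ?E2" "card (e \<inter> (V - S)) = 1 \<longleftrightarrow> card (e \<inter> S) = 1"
    if eE: "e \<in> E" for e
  proof -
    obtain a b where e: "e = {a, b}" and ab: "a \<noteq> b" "a \<in> V" "b \<in> V"
      using edge_cases[OF eE] by metis
    show "e \<in> ?E1 \<inter> ?E2 \<longleftrightarrow> e \<in> ?C" "e \<in> ?E1 \<union> ?E2" "card (e \<inter> (V - S)) = 1 \<longleftrightarrow> card (e \<inter> S) = 1"
      using eE ab unfolding e mem_Collect_eq Int_iff Un_iff One_nat_def crosses_pair[OF ab(1)]
      by auto
  qed
  have FC: "2 \<le> card (F \<inter> ?C)" if F: "F \<in> half E S \<or> F \<in> half E (V - S)" for F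
  proof -
    have "S \<noteq> {}" "S \<noteq> V" using S(2) by auto
    then have "S \<noteq> {}" "V - S \<noteq> {}" using S(1) by auto
    moreover have FE: "F \<subseteq> E" using F by (auto simp: half_def)
    ultimately have "2 \<le> card {e \<in> F. card (e \<inter> S) = 1} \<or> 2 \<le> card {e \<in> F. card (e \<inter> (V - S)) = 1}"
      using F by (auto simp: half_def cutsize_def)
    moreover have "{e \<in> F. card (e \<inter> S) = 1} = F \<inter> ?C" "{e \<in> F. card (e \<inter> (V - S)) = 1} = F \<inter> ?C"
      using C FE by auto
    ultimately show ?thesis by metis
  qed
  have "convex_comb (two_ec_sets V E) (?E1 \<union> ?E2) (\<lambda>_. 7 / 9)"
  proof (rule convex_comb_glue[OF _ _ _ _ _ _ _ _ _ cc])
    show "finite (half E S)" "finite (half E (V - S))" "finite (two_ec_sets V E)"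
      using finite_E by (auto simp: half_def finite_two_ec_sets)
    show "?C = ?E1 \<inter> ?E2" using C(1) by blast
    show "card ?C = 3" using S by (simp add: cutsize_def)
    show "F \<subseteq> ?E1" if "F \<in> half E S" for F using that by (simp add: half_def)
    show "F \<subseteq> ?E2" if "F \<in> half E (V - S)" for F using that by (simp add: half_def)
    show "F1 \<union> F2 \<in> two_ec_sets V E" if "F1 \<in> half E S" "F2 \<in> half E (V - S)" for F1 F2
      by (rule glue_two_ec[OF S that])
  qed (use FC in blast)+
  moreover have "?E1 \<union> ?E2 = E" using C(2) by blast
  ultimately show ?thesis by simp
qed

end

section \<open>Deleting two edges at distance one\<close>

locale essential = cubic_3ec +
  assumes ess: "A \<subseteq> V \<Longrightarrow> cutsize E A = 3 \<Longrightarrow> card A = 1 \<or> card (V - A) = 1"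
    and large: "4 < card V"
begin

text \<open>The cut around a triangle has 9 - 6 = 3 edges; by \<open>large\<close> it is not the cut
  of a single vertex seen from outside.\<close>

lemma no_triangle:
  assumes "b \<in> nbrs a" "c \<in> nbrs b" "c \<in> nbrs a"
  shows False
proof -
  have d: "a \<noteq> b" "b \<noteq> c" "a \<noteq> c" using assms not_nbrs_self by auto
  have abc: "a \<in> V" "b \<in> V" "c \<in> V" using assms nbrs_subset nbrs_sym by blast+
  have "cutsize E (insert c {a, b}) + 2 * card (nbrs c \<inter> {a, b}) = cutsize E {a, b} + 3"
    by (rule cutsize_insert_vertex) (use d abc in auto)
  moreover have "nbrs c \<inter> {a, b} = {a, b}" using assms nbrs_sym by blast
  moreover have "cutsize E {a, b} = 4"
    using assms(1) by (intro cutsize_edge) (simp add: nbrs_iff)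
  ultimately have "cutsize E {a, b, c} = 3" using d by (simp add: insert_commute)
  moreover have "card {a, b, c} = 3" "{a, b, c} \<subseteq> V" using d abc by auto
  ultimately show False
    using ess[of "{a, b, c}"] large card_Diff_subset[of "{a, b, c}" V] by auto
qed

end

text \<open>The edges to be deleted are \<open>{v, x1}\<close> and \<open>{v', x3}\<close>.
  Assumption \<open>good\<close> speaks only of sets that leave \<open>v\<close> and
  \<open>v'\<close> on the side of \<open>x2\<close> and \<open>x4\<close>; sets containing
  \<open>v\<close> and \<open>v'\<close> are complemented before it is applied.\<close>

locale good_config = essential V E for V :: "'a set" and E +
  fixes v v' x1 x2 x3 x4 r1 s1 r3 s3 :: 'a
  assumes nbrs_v: "nbrs v = {v', x1, x2}" and nbrs_v': "nbrs v' = {v, x3, x4}"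
    and nbrs_x1: "nbrs x1 = {v, r1, s1}" and nbrs_x3: "nbrs x3 = {v', r3, s3}"
    and good: "T \<subseteq> V \<Longrightarrow> x1 \<in> T \<Longrightarrow> x3 \<in> T \<Longrightarrow> v \<notin> T \<Longrightarrow> v' \<notin> T \<Longrightarrow> x2 \<notin> T \<Longrightarrow> x4 \<notin> T
      \<Longrightarrow> 4 < cutsize E T"
begin

lemma in_V: "v \<in> V" "v' \<in> V" "x1 \<in> V" "x2 \<in> V" "x3 \<in> V" "x4 \<in> V" "r1 \<in> V" "s1 \<in> V" "r3 \<in> V" "s3 \<in> V"
  using nbrs_subset[of v] nbrs_subset[of v'] nbrs_subset[of x1] nbrs_subset[of x3]
    nbrs_v nbrs_v' nbrs_x1 nbrs_x3 by auto

lemma distinct_nbrs: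
  "v' \<noteq> x1" "v' \<noteq> x2" "x1 \<noteq> x2" "v \<noteq> x3" "v \<noteq> x4" "x3 \<noteq> x4"
  "v \<noteq> r1" "v \<noteq> s1" "r1 \<noteq> s1" "v' \<noteq> r3" "v' \<noteq> s3" "r3 \<noteq> s3"
  using card_nbrs[of v] card_nbrs[of v'] card_nbrs[of x1] card_nbrs[of x3] in_V
  unfolding nbrs_v nbrs_v' nbrs_x1 nbrs_x3 by (auto dest!: card_three)

lemma not_self: "v \<noteq> v'" "v \<noteq> x1" "v \<noteq> x2" "v' \<noteq> x3" "v' \<noteq> x4" "x1 \<noteq> r1" "x1 \<noteq> s1" "x3 \<noteq> r3" "x3 \<noteq> s3"
  using not_nbrs_self[of v] not_nbrs_self[of v'] not_nbrs_self[of x1] not_nbrs_self[of x3]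
  unfolding nbrs_v nbrs_v' nbrs_x1 nbrs_x3 by auto

lemma no_common_nbr: "b \<in> nbrs a \<Longrightarrow> c \<in> nbrs a \<Longrightarrow> c \<notin> nbrs b"
  using no_triangle[of b a c] by blast

lemma x_distinct: "x1 \<noteq> x3" "x1 \<noteq> x4" "x2 \<noteq> x3" "x2 \<noteq> x4"
proof -
  have v: "v' \<in> nbrs v" unfolding nbrs_v by simp
  have "nbrs v \<inter> nbrs v' = {}" using no_common_nbr[OF v] by blast
  then show "x1 \<noteq> x3" "x1 \<noteq> x4" "x2 \<noteq> x3" "x2 \<noteq> x4"
    unfolding nbrs_v nbrs_v' by auto
qed

lemma rs_distinct1:
  assumes "r = r1 \<or> r = s1"
  shows "r \<noteq> v'" "r \<noteq> x2"
proof -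
  have r: "r \<in> nbrs x1" using assms nbrs_x1 by auto
  have *: "x1 \<in> nbrs v" using nbrs_v by auto
  show "r \<noteq> v'" using no_common_nbr[of v' v x1] r * nbrs_v nbrs_sym by blast
  show "r \<noteq> x2" using no_common_nbr[of x1 v x2] r * nbrs_v by blast
qed

lemma rs_distinct3:
  assumes "r = r3 \<or> r = s3"
  shows "r \<noteq> v" "r \<noteq> x4"
proof -
  have r: "r \<in> nbrs x3" using assms nbrs_x3 by auto
  have *: "x3 \<in> nbrs v'" using nbrs_v' by auto
  show "r \<noteq> v" using no_common_nbr[of v v' x3] r * nbrs_v' nbrs_sym by blast
  show "r \<noteq> x4" using no_common_nbr[of x3 v' x4] r * nbrs_v' by blast
qed

lemma x1_x3_nonadjacent: "x3 \<notin> nbrs x1"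
proof
  assume "x3 \<in> nbrs x1"
  then have "cutsize E {x1, x3} = 4" by (intro cutsize_edge) (simp add: nbrs_iff)
  then show False using good[of "{x1, x3}"] in_V distinct_nbrs not_self x_distinct by auto
qed

lemma rs_distinct: "r1 \<noteq> v'" "r1 \<noteq> x2" "s1 \<noteq> v'" "s1 \<noteq> x2" "r3 \<noteq> v" "r3 \<noteq> x4" "s3 \<noteq> v" "s3 \<noteq> x4"
    "r1 \<noteq> x3" "s1 \<noteq> x3" "r3 \<noteq> x1" "s3 \<noteq> x1"
  using rs_distinct1 rs_distinct3 x1_x3_nonadjacent nbrs_sym[of x1 x3] nbrs_x1 nbrs_x3 by auto

lemmas dist = distinct_nbrs not_self x_distinct rs_distinct
lemmas dist' = dist dist[symmetric]

text \<open>Otherwise \<open>v\<close>, \<open>v'\<close>, \<open>x4\<close>, \<open>x2\<close> form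
  a 4-cycle, whose cut has 12 - 8 = 4 edges, and the complement contradicts \<open>good\<close>. So
  the edge replacing the path through \<open>v\<close> and \<open>v'\<close> is not parallel to an
  old one.\<close>

lemma x2_x4_nonadjacent: "{x2, x4} \<notin> E"
proof
  assume x: "{x2, x4} \<in> E"
  have "cutsize E (insert v {x2, x4}) + 2 * card (nbrs v \<inter> {x2, x4}) = cutsize E {x2, x4} + 3"
    by (rule cutsize_insert_vertex) (use dist' in_V in auto)
  moreover have "nbrs v \<inter> {x2, x4} = {x2}" unfolding nbrs_v using dist' by auto
  ultimately have 5: "cutsize E {v, x2, x4} = 5" using cutsize_edge[OF x] by simp
  have "cutsize E (insert v' {v, x2, x4}) + 2 * card (nbrs v' \<inter> {v, x2, x4}) = cutsize E {v, x2, x4} + 3"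
    by (rule cutsize_insert_vertex) (use dist' in_V in auto)
  moreover have "nbrs v' \<inter> {v, x2, x4} = {v, x4}" unfolding nbrs_v' using dist' by auto
  ultimately have "cutsize E {v', v, x2, x4} = 4" using 5 dist' by simp
  then have "cutsize E (V - {v', v, x2, x4}) = 4" using cutsize_E_compl by simp
  then show False using good[of "V - {v', v, x2, x4}"] in_V dist' by auto
qed

lemma r1_s1_nonadjacent: "{r1, s1} \<notin> E"
  using no_common_nbr[of r1 x1 s1] nbrs_x1 by (auto simp: nbrs_iff)

lemma r3_s3_nonadjacent: "{r3, s3} \<notin> E"
  using no_common_nbr[of r3 x3 s3] nbrs_x3 by (auto simp: nbrs_iff)

text \<open>If the paths through \<open>x1\<close> and \<open>x3\<close> had the same ends, these
  four vertices would form a 4-cycle with a cut of 4 edges, again contradicting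
  \<open>good\<close>.\<close>

lemma new_edges_differ: "{r1, s1} \<noteq> {r3, s3}"
proof
  assume eq: "{r1, s1} = {r3, s3}"
  have rs: "nbrs r1 \<inter> {x1} = {x1}" "nbrs s1 \<inter> {r1, x1} = {x1}" "nbrs x3 \<inter> {s1, r1, x1} = {s1, r1}"
    using nbrs_x1 nbrs_x3 eq no_common_nbr[of r1 x1 s1] nbrs_sym dist' by (auto simp: doubleton_eq_iff)
  have "r1 \<noteq> x4" "s1 \<noteq> x4" using eq dist' by (auto simp: doubleton_eq_iff)
  note d = this dist'
  have "cutsize E (insert r1 {x1}) + 2 * card (nbrs r1 \<inter> {x1}) = cutsize E {x1} + 3"
    by (rule cutsize_insert_vertex) (use d in_V in auto)
  moreover have "cutsize E (insert s1 {r1, x1}) + 2 * card (nbrs s1 \<inter> {r1, x1}) = cutsize E {r1, x1} + 3"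
    by (rule cutsize_insert_vertex) (use d in_V in auto)
  moreover have "cutsize E (insert x3 {s1, r1, x1}) + 2 * card (nbrs x3 \<inter> {s1, r1, x1}) = cutsize E {s1, r1, x1} + 3"
    by (rule cutsize_insert_vertex) (use d in_V in auto)
  ultimately have "cutsize E {x3, s1, r1, x1} = 4"
    unfolding rs using deg3[of x1] in_V d by simp
  then show False using good[of "{x3, s1, r1, x1}"] in_V d by auto
qed

section \<open>The reduced graph and its 3-edge-connectivity\<close>

definition V0 where "V0 = V - {v, v', x1, x3}"
definition E0 where "E0 = {e \<in> E. e \<subseteq> V0}"
text \<open>After the two deletions, the vertices of degree 2 form the interiors of the paths
  \<open>x2 v v' x4\<close>, \<open>r1 x1 s1\<close> and \<open>r3 x3 s3\<close>; each new edge
  replaces one of these paths.\<close>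

definition E' where "E' = insert {x2, x4} (insert {r1, s1} (insert {r3, s3} E0))"

lemma finite_E0: "finite E0"
  unfolding E0_def using finite_E by simp

text \<open>Listing the nine edges at removed vertices turns cut sizes in \<open>E\<close>,
  \<open>E'\<close> and \<open>lift F\<close> into explicit sums of indicators over a common
  remainder in \<open>E0\<close>, which can then be compared by case distinction.\<close>

lemma E_eq: "E = insert {v, v'} (insert {v, x1} (insert {v, x2} (insert {v', x3} (insert {v', x4}
    (insert {x1, r1} (insert {x1, s1} (insert {x3, r3} (insert {x3, s3} E0))))))))"
  (is "_ = ?R")
proof
  show "?R \<subseteq> E"
    using nbrs_v nbrs_v' nbrs_x1 nbrs_x3 by (auto simp: E0_def nbrs_iff[symmetric])
  show "E \<subseteq> ?R"
  proof
    fix e assume e: "e \<in> E"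
    have star: "\<exists>u\<in>nbrs a. e = {a, u}" if "a \<in> e" for a
    proof -
      have "e \<in> {e \<in> E. a \<in> e}" using that e by simp
      then show ?thesis unfolding star_eq by blast
    qed
    consider "v \<in> e" | "v' \<in> e" | "x1 \<in> e" | "x3 \<in> e" | "e \<subseteq> V0"
      using edge[OF e] by (auto simp: V0_def)
    then show "e \<in> ?R"
    proof cases
      case 1
      then have "e = {v, v'} \<or> e = {v, x1} \<or> e = {v, x2}" using star[of v] nbrs_v by auto
      then show ?thesis by (elim disjE) simp_all
    next
      case 2
      then have "e = {v', v} \<or> e = {v', x3} \<or> e = {v', x4}" using star[of v'] nbrs_v' by auto
      then show ?thesis unfolding insert_commute[of v' v "{}"] by (elim disjE) simp_all
    next
      case 3
      then have "e = {x1, v} \<or> e = {x1, r1} \<or> e = {x1, s1}" using star[of x1] nbrs_x1 by auto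
      then show ?thesis unfolding insert_commute[of x1 v "{}"] by (elim disjE) simp_all
    next
      case 4
      then have "e = {x3, v'} \<or> e = {x3, r3} \<or> e = {x3, s3}" using star[of x3] nbrs_x3 by auto
      then show ?thesis unfolding insert_commute[of x3 v' "{}"] by (elim disjE) simp_all
    qed (use e in \<open>simp add: E0_def\<close>)
  qed
qed

lemma not_in_E0: "a \<notin> V0 \<Longrightarrow> {a, b} \<notin> E0"
  by (auto simp: E0_def)

lemma V0_iff: "a \<in> V0 \<longleftrightarrow> a \<in> V \<and> a \<noteq> v \<and> a \<noteq> v' \<and> a \<noteq> x1 \<and> a \<noteq> x3"
  by (auto simp: V0_def)

lemma in_V0: "x2 \<in> V0" "x4 \<in> V0" "r1 \<in> V0" "s1 \<in> V0" "r3 \<in> V0" "s3 \<in> V0"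
  using in_V dist' by (simp_all add: V0_iff)

lemma not_in_V0: "v \<notin> V0" "v' \<notin> V0" "x1 \<notin> V0" "x3 \<notin> V0"
  by (simp_all add: V0_iff)

lemma cutsize_E:
  "cutsize E A = cutsize E0 A + of_bool ((v \<in> A) \<noteq> (v' \<in> A)) + of_bool ((v \<in> A) \<noteq> (x1 \<in> A))
     + of_bool ((v \<in> A) \<noteq> (x2 \<in> A)) + of_bool ((v' \<in> A) \<noteq> (x3 \<in> A)) + of_bool ((v' \<in> A) \<noteq> (x4 \<in> A))
     + of_bool ((x1 \<in> A) \<noteq> (r1 \<in> A)) + of_bool ((x1 \<in> A) \<noteq> (s1 \<in> A))
     + of_bool ((x3 \<in> A) \<noteq> (r3 \<in> A)) + of_bool ((x3 \<in> A) \<noteq> (s3 \<in> A))"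
  by (subst E_eq)
     (simp add: cutsize_insert finite_E0 not_in_E0 not_in_V0 doubleton_eq_iff dist' crosses_pair
       del: Int_insert_left)

lemma new_edges_not_in_E0: "{x2, x4} \<notin> E0" "{r1, s1} \<notin> E0" "{r3, s3} \<notin> E0"
  using x2_x4_nonadjacent r1_s1_nonadjacent r3_s3_nonadjacent by (auto simp: E0_def)

lemma new_edges_differ': "{x2, x4} \<noteq> {r1, s1}" "{x2, x4} \<noteq> {r3, s3}"
  using dist' by (auto simp: doubleton_eq_iff)

lemma cutsize_E':
  "cutsize E' A = cutsize E0 A + of_bool ((x2 \<in> A) \<noteq> (x4 \<in> A)) + of_bool ((r1 \<in> A) \<noteq> (s1 \<in> A))
     + of_bool ((r3 \<in> A) \<noteq> (s3 \<in> A))"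
  unfolding E'_def
  by (simp add: cutsize_insert finite_E0 new_edges_not_in_E0 new_edges_differ new_edges_differ'
      dist' crosses_pair del: Int_insert_left)

lemma edge_E': "e \<in> E' \<Longrightarrow> e \<subseteq> V0 \<and> card e = 2"
  unfolding E'_def using in_V0 edge dist' by (auto simp: E0_def)

lemma cutsize_E0_cong: "A \<inter> V0 = B \<inter> V0 \<Longrightarrow> cutsize E0 A = cutsize E0 B"
  by (rule cutsize_cong) (auto simp: E0_def)

text \<open>A vertex of \<open>V0\<close> is an end of a suppressed path as often as it is an end of
  the replacing edge; the two deleted edges do not touch \<open>V0\<close>.\<close>

lemma deg3_E': "u \<in> V0 \<Longrightarrow> cutsize E' {u} = 3"
proof -
  assume u: "u \<in> V0"
  then have "cutsize E {u} = 3" "u \<noteq> v" "u \<noteq> v'" "u \<noteq> x1" "u \<noteq> x3" by (auto simp: V0_iff deg3)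
  moreover have "of_bool ((a = u) \<noteq> (b = u)) = (of_bool (a = u) + of_bool (b = u) :: nat)"
    if "a \<noteq> b" for a b using that by auto
  ultimately show ?thesis unfolding cutsize_E cutsize_E' using dist' by simp
qed

lemma conn3_E':
  assumes A: "A \<subseteq> V0" "A \<noteq> {}" "A \<noteq> V0"
  shows "3 \<le> cutsize E' A"
proof (rule ccontr)
  assume "\<not> 3 \<le> cutsize E' A"
  then have small: "cutsize E' A \<le> 2" by simp
  \<comment> \<open>\<open>L b\<close> puts \<open>x1\<close> and \<open>x3\<close> on the sides of \<open>r1\<close> and \<open>r3\<close>; the side of \<open>v\<close> and \<open>v'\<close> is left free.\<close>
  define L where "L b = A \<union> (if b then {v, v'} else {}) \<union> (if r1 \<in> A then {x1} else {})
    \<union> (if r3 \<in> A then {x3} else {})" for b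
  have L_iff: "a \<in> L b \<longleftrightarrow> a \<in> A" if "a \<in> V0" for a b
    using that not_in_V0 by (auto simp: L_def)
  have L_del: "v \<in> L b \<longleftrightarrow> b" "v' \<in> L b \<longleftrightarrow> b" "x1 \<in> L b \<longleftrightarrow> r1 \<in> A" "x3 \<in> L b \<longleftrightarrow> r3 \<in> A" for b
    using A(1) not_in_V0 dist' by (auto simp: L_def)
  have L_V: "L b \<subseteq> V" for b
    using A(1) in_V by (auto simp: L_def V0_def)
  have L_cut: "cutsize E (L b) = cutsize E' A + of_bool (b \<noteq> (r1 \<in> A)) + of_bool (b \<noteq> (r3 \<in> A))
      + of_bool (b \<noteq> (x2 \<in> A)) + of_bool (b \<noteq> (x4 \<in> A)) - of_bool ((x2 \<in> A) \<noteq> (x4 \<in> A))" for b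
  proof -
    have "cutsize E0 (L b) = cutsize E0 A"
      by (rule cutsize_E0_cong) (use L_iff in auto)
    then show ?thesis
      unfolding cutsize_E cutsize_E' by (simp add: L_del L_iff in_V0)
  qed
  \<comment> \<open>A cut of 3 edges would be trivial, making \<open>A\<close> or
    \<open>V0 - A\<close> a singleton; but singletons have degree 3 in \<open>E'\<close>, contrary
    to \<open>small\<close>.\<close>
  have four: "4 \<le> cutsize E (L b)" for b
  proof (rule ccontr)
    assume "\<not> 4 \<le> cutsize E (L b)"
    moreover have "L b \<noteq> {}" using A(2) by (simp add: L_def)
    moreover have "L b \<noteq> V"
    proof -
      obtain y where "y \<in> V0" "y \<notin> A" using A by blast
      then show ?thesis using L_iff by (auto simp: V0_def)
    qed
    ultimately have "cutsize E (L b) = 3" using conn3[OF L_V, of b] by linarith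
    then consider "card (L b) = 1" | "card (V - L b) = 1" using ess L_V by blast
    then obtain z where z: "z \<in> V0" "A = {z} \<or> V0 - A = {z}"
    proof cases
      case 1
      then obtain z where "L b = {z}" by (meson card_1_singletonE)
      then have "A = {z}" using A(2) by (auto simp: L_def)
      then show thesis using that A(1) by auto
    next
      case 2
      then obtain z where "V - L b = {z}" by (meson card_1_singletonE)
      moreover have "V0 - A \<subseteq> V - L b" using L_iff by (auto simp: V0_def)
      ultimately have "V0 - A \<subseteq> {z}" by simp
      moreover have "V0 - A \<noteq> {}" using A(1,3) by auto
      ultimately have "V0 - A = {z}" by (metis subset_singletonD)
      then show thesis using that by blast
    qed
    have "cutsize E' A = cutsize E' {z}"
      using z(2)
    proof
      assume "V0 - A = {z}"
      then have "A = V0 - {z}" using A(1) by blast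
      then show ?thesis using cutsize_compl[of E' V0 "{z}"] edge_E' by auto
    qed simp
    then show False using deg3_E'[OF z(1)] small by simp
  qed
  \<comment> \<open>Put \<open>v\<close> and \<open>v'\<close> on the side of \<open>r1\<close>. If
    \<open>x2\<close> and \<open>x4\<close> were separated, the one edge cut at the ends of their
    path would be paid for by the new edge \<open>{x2, x4}\<close>; only \<open>{v', x3}\<close>
    could be extra, giving at most 3 edges.\<close>
  have x24: "x2 \<in> A \<longleftrightarrow> x4 \<in> A"
    using L_cut[of "r1 \<in> A"] four[of "r1 \<in> A"] small
    by (cases "r1 \<in> A"; cases "r3 \<in> A"; cases "x2 \<in> A"; cases "x4 \<in> A") simp_all
  \<comment> \<open>Now put \<open>v\<close> and \<open>v'\<close> on the common side of
    \<open>x2\<close> and \<open>x4\<close>. Only the deleted edges can be extra, and reaching 4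
    requires both, so \<open>x1\<close> and \<open>x3\<close> lie opposite.\<close>
  define b where "b \<longleftrightarrow> x2 \<in> A"
  have b: "b \<noteq> (r1 \<in> A)" "b \<noteq> (r3 \<in> A)" "cutsize E (L b) \<le> 4"
    using L_cut[of b] four[of b] small x24 unfolding b_def
    by (cases "r1 \<in> A"; cases "r3 \<in> A"; cases "x2 \<in> A"; simp)+
  define T where "T = (if b then V - L b else L b)"
  have "cutsize E T \<le> 4" using b(3) cutsize_E_compl[of "L b"] by (cases b) (simp_all add: T_def)
  moreover have "4 < cutsize E T"
  proof (rule good)
    show "T \<subseteq> V" using L_V by (auto simp: T_def)
    show "x1 \<in> T" "x3 \<in> T" "v \<notin> T" "v' \<notin> T" "x2 \<notin> T" "x4 \<notin> T"
      using b(1,2) L_del[of b] L_iff[OF in_V0(1), of b] L_iff[OF in_V0(2), of b] x24 in_V b_def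
      by (auto simp: T_def)
  qed
  ultimately show False by simp
qed

lemma cubic_3ec_reduced: "cubic_3ec V0 E'"
  by unfold_locales (use finite_V V0_def edge_E' deg3_E' conn3_E' in auto)

lemma card_V0: "card V0 < card V"
  unfolding V0_def by (rule psubset_card_mono) (use finite_V in_V in auto)

text \<open>The paths are included even where \<open>F\<close> misses the edge replacing them: the
  coordinates of the three new edges are discarded.\<close>

definition lift :: "'a set set \<Rightarrow> 'a set set" where
  "lift F = insert {v, v'} (insert {v, x2} (insert {v', x4} (insert {x1, r1} (insert {x1, s1}
    (insert {x3, r3} (insert {x3, s3} (F \<inter> E0)))))))"

lemma cutsize_lift:
  "cutsize (lift F) A = cutsize (F \<inter> E0) A + of_bool ((v \<in> A) \<noteq> (v' \<in> A))
     + of_bool ((v \<in> A) \<noteq> (x2 \<in> A)) + of_bool ((v' \<in> A) \<noteq> (x4 \<in> A))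
     + of_bool ((x1 \<in> A) \<noteq> (r1 \<in> A)) + of_bool ((x1 \<in> A) \<noteq> (s1 \<in> A))
     + of_bool ((x3 \<in> A) \<noteq> (r3 \<in> A)) + of_bool ((x3 \<in> A) \<noteq> (s3 \<in> A))"
  unfolding lift_def
  by (simp add: cutsize_insert finite_E0 not_in_E0 not_in_V0 doubleton_eq_iff dist' crosses_pair
      del: Int_insert_left)

lemma cutsize_le_reduced:
  assumes "F \<subseteq> E'"
  shows "cutsize F A \<le> cutsize (F \<inter> E0) A + of_bool ((x2 \<in> A) \<noteq> (x4 \<in> A))
    + of_bool ((r1 \<in> A) \<noteq> (s1 \<in> A)) + of_bool ((r3 \<in> A) \<noteq> (s3 \<in> A))"
proof -
  have "cutsize F A \<le> cutsize (insert {x2, x4} (insert {r1, s1} (insert {r3, s3} (F \<inter> E0)))) A"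
    by (rule cutsize_mono) (use assms finite_E0 in \<open>auto simp: E'_def\<close>)
  also have "\<dots> = cutsize (F \<inter> E0) A + of_bool ((x2 \<in> A) \<noteq> (x4 \<in> A))
    + of_bool ((r1 \<in> A) \<noteq> (s1 \<in> A)) + of_bool ((r3 \<in> A) \<noteq> (s3 \<in> A))"
    by (simp add: cutsize_insert finite_E0 new_edges_not_in_E0 new_edges_differ new_edges_differ'
      dist' crosses_pair del: Int_insert_left)
  finally show ?thesis .
qed

lemma lift_two_ec:
  assumes F: "F \<in> two_ec_sets V0 E'"
  shows "lift F \<in> two_ec_sets V E"
proof -
  have "2 \<le> cutsize (lift F) A" if A: "A \<subseteq> V" "A \<noteq> {}" "A \<noteq> V" for A
  proof -
    consider "A \<inter> V0 = {}" | "A \<inter> V0 = V0" | "A \<inter> V0 \<noteq> {}" "A \<inter> V0 \<noteq> V0" by blast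
    then show ?thesis
    proof cases
      case 1
      \<comment> \<open>Here \<open>A\<close> consists of interior vertices of paths whose ends lie
        outside, so such a path is crossed in both directions.\<close>
      then have "x2 \<notin> A" "x4 \<notin> A" "r1 \<notin> A" "s1 \<notin> A" "r3 \<notin> A" "s3 \<notin> A" using in_V0 by blast+
      moreover have "v \<in> A \<or> v' \<in> A \<or> x1 \<in> A \<or> x3 \<in> A" using A 1 by (auto simp: V0_def)
      ultimately show ?thesis unfolding cutsize_lift by auto
    next
      case 2
      then have "x2 \<in> A" "x4 \<in> A" "r1 \<in> A" "s1 \<in> A" "r3 \<in> A" "s3 \<in> A" using in_V0 by blast+
      moreover have "v \<notin> A \<or> v' \<notin> A \<or> x1 \<notin> A \<or> x3 \<notin> A" using A 2 by (auto simp: V0_def)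
      ultimately show ?thesis unfolding cutsize_lift by auto
    next
      case 3
      have sub: "F \<subseteq> E'" using F by (simp add: two_ec_sets_def)
      have "cutsize F A = cutsize F (A \<inter> V0)"
        by (rule cutsize_cong) (use sub edge_E' in blast)
      also have "2 \<le> \<dots>" using F 3 by (auto simp: two_ec_sets_def two_ec_def)
      finally have "2 \<le> cutsize (F \<inter> E0) A + of_bool ((x2 \<in> A) \<noteq> (x4 \<in> A))
        + of_bool ((r1 \<in> A) \<noteq> (s1 \<in> A)) + of_bool ((r3 \<in> A) \<noteq> (s3 \<in> A))"
        using cutsize_le_reduced[OF sub, of A] by linarith
      \<comment> \<open>A triangle inequality for separation: a path with separated ends has a
        crossing edge, so every crossing new edge is paid for by its path. It is used twice along
        \<open>x2 v v' x4\<close> and once on each other path.\<close>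
      moreover have "of_bool (a \<noteq> c) \<le> of_bool (a \<noteq> b) + (of_bool (b \<noteq> c) :: nat)" for a b c :: bool
        by auto
      note this[of "x2 \<in> A" "x4 \<in> A" "v \<in> A"] this[of "v \<in> A" "x4 \<in> A" "v' \<in> A"]
        this[of "r1 \<in> A" "s1 \<in> A" "x1 \<in> A"] this[of "r3 \<in> A" "s3 \<in> A" "x3 \<in> A"]
      ultimately show ?thesis unfolding cutsize_lift by (simp only: neq_commute)
    qed
  qed
  moreover have "lift F \<subseteq> E"
    using nbrs_v nbrs_v' nbrs_x1 nbrs_x3 by (auto simp: lift_def E0_def nbrs_iff[symmetric])
  ultimately show ?thesis by (simp add: two_ec_sets_def two_ec_def)
qed

definition reduction_vector :: "'a set \<Rightarrow> real" where
  "reduction_vector h = (if h = {v, x1} \<or> h = {v', x3} then 0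
     else if v \<in> h \<or> v' \<in> h \<or> x1 \<in> h \<or> x3 \<in> h then 1 else 7 / 9)"

lemma convex_comb_reduction:
  assumes "convex_comb (two_ec_sets V0 E') E' (\<lambda>_. 7 / 9)"
  shows "convex_comb (two_ec_sets V E) E reduction_vector"
proof (rule convex_comb_map[OF assms, where f = lift and g = id])
  show "finite (two_ec_sets V0 E')" "finite (two_ec_sets V E)"
    using finite_E finite_E0 by (auto simp: E'_def intro!: finite_two_ec_sets)
  show "F \<in> two_ec_sets V0 E' \<Longrightarrow> lift F \<in> two_ec_sets V E" for F by (rule lift_two_ec)
  fix h assume "h \<in> E"
  then have "(h = {v, x1} \<or> h = {v', x3})
    \<or> h \<in> {{v, v'}, {v, x2}, {v', x4}, {x1, r1}, {x1, s1}, {x3, r3}, {x3, s3}} \<or> h \<in> E0"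
    by (subst (asm) E_eq) (elim insertE; simp)
  then consider "h = {v, x1} \<or> h = {v', x3}"
    | "h \<in> {{v, v'}, {v, x2}, {v', x4}, {x1, r1}, {x1, s1}, {x3, r3}, {x3, s3}}"
    | "h \<in> E0" by argo
  then show "id h \<in> E' \<and> (\<forall>F\<in>two_ec_sets V0 E'. (h \<in> lift F) = (id h \<in> F)) \<and> reduction_vector h = 7 / 9 \<or>
      (\<forall>F\<in>two_ec_sets V0 E'. h \<in> lift F) \<and> reduction_vector h = 1 \<or>
      (\<forall>F\<in>two_ec_sets V0 E'. h \<notin> lift F) \<and> reduction_vector h = 0"
  proof cases
    case 1
    have "{v, x1} \<notin> lift F" "{v', x3} \<notin> lift F" for F
      by (simp_all add: lift_def doubleton_eq_iff dist' not_in_E0 not_in_V0)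
    then have "\<forall>F\<in>two_ec_sets V0 E'. h \<notin> lift F" using 1 by metis
    then show ?thesis using 1 by (simp add: reduction_vector_def)
  next
    case 2
    then have "h \<in> lift F" for F unfolding lift_def by (elim insertE emptyE; simp)
    moreover have "reduction_vector h = 1"
      unfolding reduction_vector_def using 2 dist' by (auto simp: doubleton_eq_iff)
    ultimately show ?thesis by blast
  next
    case 3
    then have h: "h \<subseteq> V0" by (simp add: E0_def)
    then have "reduction_vector h = 7 / 9"
      unfolding reduction_vector_def using not_in_V0 by auto
    moreover have "h \<in> lift F \<longleftrightarrow> h \<in> F" for F
      unfolding lift_def using 3 h not_in_V0 by auto
    moreover have "h \<in> E'" using 3 by (simp add: E'_def)
    ultimately show ?thesis by simp
  qed
qed

end

section \<open>The complete graph and the complete bipartite graph\<close>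

lemma two_ec_mono: "finite F' \<Longrightarrow> F \<subseteq> F' \<Longrightarrow> two_ec V F \<Longrightarrow> two_ec V F'"
  unfolding two_ec_def using cutsize_mono by (metis order_trans)

text \<open>Going round a cycle changes sides an even number of times, and at least once if
  \<open>A\<close> is proper and nonempty.\<close>

lemma two_ec_cycle4:
  assumes "distinct [a, b, c, d]"
  shows "two_ec {a, b, c, d} {{a, b}, {b, c}, {c, d}, {d, a}}"
  unfolding two_ec_def
proof (intro allI impI)
  fix A assume A: "A \<subseteq> {a, b, c, d} \<and> A \<noteq> {} \<and> A \<noteq> {a, b, c, d}"
  have "cutsize {{a, b}, {b, c}, {c, d}, {d, a}} A = of_bool ((a \<in> A) \<noteq> (b \<in> A))
      + of_bool ((b \<in> A) \<noteq> (c \<in> A)) + of_bool ((c \<in> A) \<noteq> (d \<in> A)) + of_bool ((d \<in> A) \<noteq> (a \<in> A))"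
    using assms by (auto simp: cutsize_insert doubleton_eq_iff crosses_pair simp del: Int_insert_left)
  moreover have "a \<in> A \<or> b \<in> A \<or> c \<in> A \<or> d \<in> A" "a \<notin> A \<or> b \<notin> A \<or> c \<notin> A \<or> d \<notin> A"
    using A by blast+
  ultimately show "2 \<le> cutsize {{a, b}, {b, c}, {c, d}, {d, a}} A"
    by (cases "a \<in> A"; cases "b \<in> A"; cases "c \<in> A"; cases "d \<in> A") simp_all
qed

lemma two_ec_cycle6:
  assumes "distinct [a, b, c, d, e, f]"
  shows "two_ec {a, b, c, d, e, f} {{a, b}, {b, c}, {c, d}, {d, e}, {e, f}, {f, a}}"
  unfolding two_ec_def
proof (intro allI impI)
  fix A assume A: "A \<subseteq> {a, b, c, d, e, f} \<and> A \<noteq> {} \<and> A \<noteq> {a, b, c, d, e, f}"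
  have "cutsize {{a, b}, {b, c}, {c, d}, {d, e}, {e, f}, {f, a}} A = of_bool ((a \<in> A) \<noteq> (b \<in> A))
      + of_bool ((b \<in> A) \<noteq> (c \<in> A)) + of_bool ((c \<in> A) \<noteq> (d \<in> A)) + of_bool ((d \<in> A) \<noteq> (e \<in> A))
      + of_bool ((e \<in> A) \<noteq> (f \<in> A)) + of_bool ((f \<in> A) \<noteq> (a \<in> A))"
    using assms by (auto simp: cutsize_insert doubleton_eq_iff crosses_pair simp del: Int_insert_left)
  moreover have "a \<in> A \<or> b \<in> A \<or> c \<in> A \<or> d \<in> A \<or> e \<in> A \<or> f \<in> A"
    "a \<notin> A \<or> b \<notin> A \<or> c \<notin> A \<or> d \<notin> A \<or> e \<notin> A \<or> f \<notin> A"
    using A by blast+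
  ultimately show "2 \<le> cutsize {{a, b}, {b, c}, {c, d}, {d, e}, {e, f}, {f, a}} A"
    by (cases "a \<in> A"; cases "b \<in> A"; cases "c \<in> A"; cases "d \<in> A"; cases "e \<in> A"; cases "f \<in> A")
       simp_all
qed

context cubic_3ec
begin

text \<open>Applied to a Hamilton cycle \<open>C\<close> avoiding a matching \<open>M\<close>. The
  set \<open>V'\<close> is kept apart from \<open>V\<close> because the cycle lemmas list the
  vertices in cyclic order.\<close>

lemma two_ec_setsI:
  "two_ec V' C \<Longrightarrow> V' = V \<Longrightarrow> C \<subseteq> E - M \<Longrightarrow> E - M \<in> two_ec_sets V E"
  using two_ec_mono[of "E - M" C V] finite_E by (auto simp: two_ec_sets_def)

lemma convex_comb_K4:
  assumes "card V = 4"
  shows "convex_comb (two_ec_sets V E) E (\<lambda>_. 7 / 9)"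
proof -
  have nbrs: "nbrs u = V - {u}" if u: "u \<in> V" for u
  proof (rule card_subset_eq)
    show "finite (V - {u})" using finite_V by simp
    show "nbrs u \<subseteq> V - {u}" using nbrs_subset not_nbrs_self by auto
    show "card (nbrs u) = card (V - {u})" using u assms by (simp add: card_nbrs)
  qed
  obtain l where "distinct l" "set l = V" "length l = 4"
    using finite_distinct_list[OF finite_V] assms by (metis distinct_card)
  then obtain a b c d where V: "V = {a, b, c, d}" and d: "distinct [a, b, c, d]"
    by (auto simp: numeral_eq_Suc length_Suc_conv)
  have E: "{p, q} \<in> E" if "p \<in> V" "q \<in> V" "p \<noteq> q" for p q
    using nbrs[OF that(1)] that by (auto simp: nbrs_iff[symmetric])
  have cov: "E \<subseteq> {{a, b}, {c, d}} \<union> {{a, c}, {b, d}} \<union> {{a, d}, {b, c}}"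
  proof
    fix e assume "e \<in> E"
    then obtain p q where "e = {p, q}" "p \<noteq> q" "p \<in> V" "q \<in> V" by (rule edge_cases)
    then show "e \<in> {{a, b}, {c, d}} \<union> {{a, c}, {b, d}} \<union> {{a, d}, {b, c}}"
      unfolding V by (auto simp: doubleton_eq_iff)
  qed
  show ?thesis
  proof (rule convex_comb_three_factors[OF finite_E _ _ _ cov])
    show "E - {{a, b}, {c, d}} \<in> two_ec_sets V E"
      by (rule two_ec_setsI[OF two_ec_cycle4[of a c b d]]) (use d E in \<open>auto simp: V doubleton_eq_iff\<close>)
    show "E - {{a, c}, {b, d}} \<in> two_ec_sets V E"
      by (rule two_ec_setsI[OF two_ec_cycle4[of a b c d]]) (use d E in \<open>auto simp: V doubleton_eq_iff\<close>)
    show "E - {{a, d}, {b, c}} \<in> two_ec_sets V E"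
      by (rule two_ec_setsI[OF two_ec_cycle4[of a b d c]]) (use d E in \<open>auto simp: V doubleton_eq_iff\<close>)
  qed
qed

lemma convex_comb_K33:
  assumes V: "V = {a1, a2, a3, b1, b2, b3}" and d: "distinct [a1, a2, a3, b1, b2, b3]"
    and nbrs: "nbrs a1 = {b1, b2, b3}" "nbrs a2 = {b1, b2, b3}" "nbrs a3 = {b1, b2, b3}"
  shows "convex_comb (two_ec_sets V E) E (\<lambda>_. 7 / 9)"
proof -
  \<comment> \<open>The three \<open>a\<close>-vertices already exhaust the degree of each
    \<open>b\<close>-vertex.\<close>
  have nb: "q \<in> {a1, a2, a3}" if "q \<in> nbrs p" "p \<in> {b1, b2, b3}" for p q
  proof -
    have "card {a1, a2, a3} = card (nbrs p)" using that(2) d V by (subst card_nbrs) auto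
    moreover have "{a1, a2, a3} \<subseteq> nbrs p" using that(2) nbrs nbrs_sym by blast
    ultimately have "{a1, a2, a3} = nbrs p" using finite_nbrs by (intro card_subset_eq) auto
    then show ?thesis using that(1) by simp
  qed
  have edges: "{p, q} \<in> E" "{q, p} \<in> E" if "p \<in> {a1, a2, a3}" "q \<in> {b1, b2, b3}" for p q
    using that nbrs by (auto simp: nbrs_iff[symmetric] insert_commute)
  have cov: "E \<subseteq> {{a1, b1}, {a2, b2}, {a3, b3}} \<union> {{a1, b2}, {a2, b3}, {a3, b1}}
      \<union> {{a1, b3}, {a2, b1}, {a3, b2}}"
  proof
    fix e assume e: "e \<in> E"
    then obtain p q where pq: "e = {p, q}" "p \<in> V" "q \<in> V" by (rule edge_cases)
    have "q \<in> nbrs p" "p \<in> nbrs q" using e pq by (auto simp: nbrs_iff insert_commute)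
    then have "(p \<in> {a1, a2, a3} \<and> q \<in> {b1, b2, b3}) \<or> (q \<in> {a1, a2, a3} \<and> p \<in> {b1, b2, b3})"
      using pq(2) nb[of q p] nbrs V by blast
    then show "e \<in> {{a1, b1}, {a2, b2}, {a3, b3}} \<union> {{a1, b2}, {a2, b3}, {a3, b1}}
      \<union> {{a1, b3}, {a2, b1}, {a3, b2}}"
    proof
      assume "p \<in> {a1, a2, a3} \<and> q \<in> {b1, b2, b3}"
      then show ?thesis unfolding pq(1) by (elim conjE insertE emptyE; simp)
    next
      assume "q \<in> {a1, a2, a3} \<and> p \<in> {b1, b2, b3}"
      then show ?thesis unfolding pq(1) insert_commute[of p q] by (elim conjE insertE emptyE; simp)
    qed
  qed
  show ?thesis
  proof (rule convex_comb_three_factors[OF finite_E _ _ _ cov])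
    show "E - {{a1, b1}, {a2, b2}, {a3, b3}} \<in> two_ec_sets V E"
      by (rule two_ec_setsI[OF two_ec_cycle6[of a1 b2 a3 b1 a2 b3]]) (use d edges in \<open>auto simp: V doubleton_eq_iff\<close>)
    show "E - {{a1, b2}, {a2, b3}, {a3, b1}} \<in> two_ec_sets V E"
      by (rule two_ec_setsI[OF two_ec_cycle6[of a1 b1 a2 b2 a3 b3]]) (use d edges in \<open>auto simp: V doubleton_eq_iff\<close>)
    show "E - {{a1, b3}, {a2, b1}, {a3, b2}} \<in> two_ec_sets V E"
      by (rule two_ec_setsI[OF two_ec_cycle6[of a1 b1 a3 b3 a2 b2]]) (use d edges in \<open>auto simp: V doubleton_eq_iff\<close>)
  qed
qed

section \<open>Averaging over all edges\<close>

definition neighbour_ind :: "'a set \<Rightarrow> 'a \<Rightarrow> real" where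
  "neighbour_ind e x = of_bool (x \<notin> e \<and> nbrs x \<inter> e \<noteq> {})"

text \<open>\<open>edge_vector {v, v'}\<close> is the average of the two reduction vectors of a pairing.  An edge adjacent to
  \<open>{v, v'}\<close> has one endpoint counted by \<open>neighbour_ind\<close>, which is why the coefficient is \<open>7/18\<close> and not
  \<open>5/18\<close>; the sum over all edges is then estimated vertex by vertex.\<close>

definition edge_vector :: "'a set \<Rightarrow> 'a set \<Rightarrow> real" where
  "edge_vector e h = 7/9 + 2/9 * of_bool (h = e) - 7/18 * of_bool (card (e \<inter> h) = 1)
     + 1/9 * (\<Sum>x\<in>h. neighbour_ind e x)"

text \<open>Each of the three neighbours of \<open>x\<close> has two further edges. This is only an
  upper bound, since an edge joining two neighbours is counted twice.\<close>

lemma sum_neighbour_ind: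
  assumes x: "x \<in> V"
  shows "(\<Sum>e\<in>E. neighbour_ind e x) \<le> 6"
proof -
  have "{e \<in> E. x \<notin> e \<and> nbrs x \<inter> e \<noteq> {}} \<subseteq> (\<Union>u\<in>nbrs x. {e \<in> E. u \<in> e} - {{u, x}})"
    by auto
  then have "card {e \<in> E. x \<notin> e \<and> nbrs x \<inter> e \<noteq> {}} \<le> card (\<Union>u\<in>nbrs x. {e \<in> E. u \<in> e} - {{u, x}})"
    by (rule card_mono[rotated]) (simp add: finite_nbrs finite_E)
  also have "\<dots> \<le> (\<Sum>u\<in>nbrs x. card ({e \<in> E. u \<in> e} - {{u, x}}))"
    by (rule card_UN_le) (rule finite_nbrs)
  also have "\<dots> \<le> (\<Sum>u\<in>nbrs x. 2)"
  proof (rule sum_mono)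
    fix u assume u: "u \<in> nbrs x"
    have "u \<in> V" using u nbrs_subset by blast
    moreover have "{u, x} \<in> E" using u by (simp add: nbrs_iff insert_commute)
    ultimately show "card ({e \<in> E. u \<in> e} - {{u, x}}) \<le> 2"
      using deg3[of u] by (simp add: cutsize_singleton)
  qed
  also have "\<dots> = 6" using card_nbrs[OF x] by simp
  finally have "card {e \<in> E. x \<notin> e \<and> nbrs x \<inter> e \<noteq> {}} \<le> 6" .
  moreover have "(\<Sum>e\<in>E. neighbour_ind e x) = card {e \<in> E. x \<notin> e \<and> nbrs x \<inter> e \<noteq> {}}"
    unfolding neighbour_ind_def using finite_E by (simp add: Int_def)
  ultimately show ?thesis by simp
qed

text \<open>The excess over 7/9 sums to at most 2/9 - 4 * 7/18 + 12 * 1/9 = 0: four edges are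
  adjacent to \<open>h\<close>, and each of its two ends contributes at most 6.\<close>

lemma sum_edge_vector:
  assumes h: "h \<in> E"
  shows "(\<Sum>e\<in>E. edge_vector e h) \<le> 7/9 * card E"
proof -
  obtain a b where ab: "h = {a, b}" "a \<noteq> b" "a \<in> V" "b \<in> V" using h by (rule edge_cases)
  have "(\<Sum>e\<in>E. of_bool (card (e \<inter> h) = 1)) = (of_nat (cutsize E h) :: real)"
    unfolding cutsize_def using finite_E by (simp add: Int_def)
  also have "cutsize E h = 4" using cutsize_edge[of a b] ab h by simp
  finally have 1: "(\<Sum>e\<in>E. of_bool (card (e \<inter> h) = 1)) = (4 :: real)" by simp
  have 2: "(\<Sum>e\<in>E. of_bool (h = e)) = (1 :: real)"
    using finite_E h by (simp add: of_bool_def)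
  have "(\<Sum>e\<in>E. \<Sum>x\<in>h. neighbour_ind e x) = (\<Sum>x\<in>h. \<Sum>e\<in>E. neighbour_ind e x)"
    by (rule sum.swap)
  also have "\<dots> \<le> 12"
    using sum_neighbour_ind[of a] sum_neighbour_ind[of b] ab by simp
  finally have 3: "(\<Sum>e\<in>E. \<Sum>x\<in>h. neighbour_ind e x) \<le> 12" .
  have "(\<Sum>e\<in>E. edge_vector e h) = (\<Sum>e\<in>E. 7/9) + 2/9 * (\<Sum>e\<in>E. of_bool (h = e))
      - 7/18 * (\<Sum>e\<in>E. of_bool (card (e \<inter> h) = 1)) + 1/9 * (\<Sum>e\<in>E. \<Sum>x\<in>h. neighbour_ind e x)"
    unfolding edge_vector_def sum.distrib sum_subtractf sum_distrib_left ..
  then show ?thesis using 1 2 3 by simp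
qed

lemma convex_comb_average:
  assumes "E \<noteq> {}" "\<And>e. e \<in> E \<Longrightarrow> convex_comb (two_ec_sets V E) E (edge_vector e)"
  shows "convex_comb (two_ec_sets V E) E (\<lambda>_. 7 / 9)"
proof (rule convex_comb_two_ec_upward)
  have "card E > 0" using assms(1) finite_E by auto
  then show "convex_comb (two_ec_sets V E) E (\<lambda>h. \<Sum>e\<in>E. 1 / card E * edge_vector e h)"
    by (intro convex_comb_sum assms(2) finite_E) auto
  show "(\<Sum>e\<in>E. 1 / card E * edge_vector e h) \<le> 7 / 9" if "h \<in> E" for h
  proof -
    have "(\<Sum>e\<in>E. 1 / card E * edge_vector e h) = (\<Sum>e\<in>E. edge_vector e h) / card E"
      unfolding sum_divide_distrib by simp
    also have "\<dots> \<le> 7 / 9"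
      using sum_edge_vector[OF that] \<open>card E > 0\<close> by (simp add: divide_simps)
    finally show ?thesis .
  qed
qed (auto simp: finite_E)

lemma nbrs_obtain:
  assumes "v \<in> V" "u \<in> nbrs v"
  obtains a b where "nbrs v = {u, a, b}" "a \<noteq> b" "a \<noteq> u" "b \<noteq> u"
proof -
  have "card (nbrs v - {u}) = 2" using card_nbrs[OF assms(1)] assms(2) by simp
  then obtain a b where "nbrs v - {u} = {a, b}" "a \<noteq> b" by (auto simp: card_2_iff)
  then show thesis using that[of a b] assms(2) by blast
qed

end

section \<open>Uncrossing the two pairings at an edge\<close>

context essential
begin

text \<open>Such a \<open>T\<close> is a witness against \<open>good\<close> for the deletion at
  \<open>A\<close>, with \<open>v\<close> and \<open>v'\<close> on the side of
  \<open>B\<close>.\<close>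

definition separates :: "'a \<Rightarrow> 'a \<Rightarrow> 'a set \<Rightarrow> 'a set \<Rightarrow> 'a set \<Rightarrow> bool" where
  "separates v v' A B T \<longleftrightarrow> T \<subseteq> V \<and> A \<subseteq> T \<and> T \<inter> insert v (insert v' B) = {} \<and> cutsize E T \<le> 4"

text \<open>Moving \<open>v'\<close> and then \<open>v\<close> into \<open>T\<close> changes the cut
  by +1 and -1, since \<open>v'\<close> has the single neighbour \<open>c\<close> there and
  \<open>v\<close> then has \<open>a\<close> and \<open>v'\<close>. Hence separation depends only on
  the pairing, not on which half is deleted.\<close>

lemma separates_compl:
  assumes nbrs: "nbrs v = {v', a, b}" "nbrs v' = {v, c, d}"
    and T: "separates v v' {a, c} {b, d} T"
  shows "separates v v' {b, d} {a, c} (V - insert v (insert v' T))"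
proof -
  have V: "v \<in> V" "v' \<in> V" "b \<in> V" "d \<in> V"
    using nbrs nbrs_subset[of v] nbrs_subset[of v'] by auto
  have ne: "v \<noteq> v'" "b \<noteq> v" "d \<noteq> v'" using nbrs not_nbrs_self[of v] not_nbrs_self[of v'] by auto
  have no: "b \<noteq> v'" "d \<noteq> v"
    using card_nbrs[OF V(1)] card_nbrs[OF V(2)] unfolding nbrs
    by (auto dest!: card_three)
  have T': "T \<subseteq> V" "a \<in> T" "c \<in> T" "v \<notin> T" "v' \<notin> T" "b \<notin> T" "d \<notin> T" "cutsize E T \<le> 4"
    using T by (auto simp: separates_def)
  have "cutsize E (insert v' T) + 2 * card (nbrs v' \<inter> T) = cutsize E T + 3"
    by (rule cutsize_insert_vertex) (use T' V in auto)
  moreover have "nbrs v' \<inter> T = {c}" unfolding nbrs using T' by auto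
  moreover have "cutsize E (insert v (insert v' T)) + 2 * card (nbrs v \<inter> insert v' T)
      = cutsize E (insert v' T) + 3"
    by (rule cutsize_insert_vertex) (use T' V ne in auto)
  moreover have "nbrs v \<inter> insert v' T = {v', a}" unfolding nbrs using T' by auto
  moreover have "a \<noteq> v'" using T' by auto
  ultimately have "cutsize E (insert v (insert v' T)) \<le> 4" using T' by simp
  then show ?thesis
    unfolding separates_def cutsize_E_compl using T' V ne no by auto
qed

text \<open>Adding \<open>v'\<close> and then \<open>v\<close> to \<open>P \<union> Q\<close> lowers
  the cut by 1 each time, and the result still has at least 3 edges, so the cut of
  \<open>P \<union> Q\<close> has at least 5. Submodularity leaves at most 4 + 4 - 5 = 3 for
  \<open>P \<inter> Q\<close>, which is therefore a trivial cut.\<close>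

lemma separates_Int:
  assumes nbrs: "nbrs v = {v', a, b}" "nbrs v' = {v, c, d}"
    and P: "separates v v' {a, c} {b, d} P" and Q: "separates v v' {a, d} {b, c} Q"
  shows "P \<inter> Q = {a}"
proof -
  have V: "v \<in> V" "v' \<in> V" "b \<in> V" "d \<in> V"
    using nbrs nbrs_subset[of v] nbrs_subset[of v'] by auto
  have ne: "v \<noteq> v'" "b \<noteq> v" using nbrs not_nbrs_self[of v] not_nbrs_self[of v'] by auto
  have no: "b \<noteq> v'" "c \<noteq> d"
    using card_nbrs[OF V(1)] card_nbrs[OF V(2)] unfolding nbrs
    by (auto dest!: card_three)
  have PQ: "P \<subseteq> V" "Q \<subseteq> V" "a \<in> P" "a \<in> Q" "c \<in> P" "d \<in> Q" "v \<notin> P" "v \<notin> Q" "v' \<notin> P" "v' \<notin> Q"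
    "b \<notin> P" "b \<notin> Q" "cutsize E P \<le> 4" "cutsize E Q \<le> 4"
    using P Q by (auto simp: separates_def)
  let ?U = "P \<union> Q"
  have "cutsize E (insert v' ?U) + 2 * card (nbrs v' \<inter> ?U) = cutsize E ?U + 3"
    by (rule cutsize_insert_vertex) (use PQ V in auto)
  moreover have "nbrs v' \<inter> ?U = {c, d}" unfolding nbrs using PQ by auto
  moreover have "cutsize E (insert v (insert v' ?U)) + 2 * card (nbrs v \<inter> insert v' ?U)
      = cutsize E (insert v' ?U) + 3"
    by (rule cutsize_insert_vertex) (use PQ V ne in auto)
  moreover have "nbrs v \<inter> insert v' ?U = {v', a}" unfolding nbrs using PQ by auto
  moreover have "a \<noteq> v'" using PQ by auto
  moreover have "3 \<le> cutsize E (insert v (insert v' ?U))"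
  proof (rule conn3)
    have "b \<notin> insert v (insert v' ?U)" using PQ ne no by auto
    then show "insert v (insert v' ?U) \<noteq> V" using V by auto
  qed (use PQ V in auto)
  ultimately have "5 \<le> cutsize E ?U" using no by simp
  moreover have "cutsize E (P \<inter> Q) + cutsize E ?U \<le> cutsize E P + cutsize E Q"
    by (rule cutsize_submodular) (use finite_E edge in auto)
  moreover have "3 \<le> cutsize E (P \<inter> Q)"
  proof (rule conn3)
    show "P \<inter> Q \<noteq> {}" using PQ(3,4) by blast
    show "P \<inter> Q \<noteq> V" using PQ(7) V(1) by blast
  qed (use PQ in auto)
  ultimately have "cutsize E (P \<inter> Q) = 3" using PQ by linarith
  moreover have "P \<inter> Q \<subseteq> V" using PQ by blast
  ultimately have "card (P \<inter> Q) = 1 \<or> card (V - P \<inter> Q) = 1" using ess by blast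
  moreover have "card (V - P \<inter> Q) \<noteq> 1"
  proof
    assume "card (V - P \<inter> Q) = 1"
    then obtain z where z: "V - P \<inter> Q = {z}" by (meson card_1_singletonE)
    moreover have "v \<in> V - P \<inter> Q" "v' \<in> V - P \<inter> Q" using PQ V by auto
    ultimately show False using ne by (metis singletonD)
  qed
  ultimately obtain z where "P \<inter> Q = {z}" by (meson card_1_singletonE)
  moreover have "a \<in> P \<inter> Q" using PQ by simp
  ultimately show ?thesis by simp
qed

text \<open>Both sets and their complements without \<open>v\<close> and \<open>v'\<close> are
  separating, so each of the four cells they form is a single \<open>x_i\<close> by
  \<open>separates_Int\<close>.\<close>

lemma both_pairings_separated:
  assumes nbrs: "nbrs v = {v', x1, x2}" "nbrs v' = {v, x3, x4}"
    and P: "separates v v' {x1, x3} {x2, x4} P" and Q: "separates v v' {x1, x4} {x2, x3} Q"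
  shows "V = {v, x3, x4, v', x1, x2}"
proof -
  define P' Q' where "P' = V - insert v (insert v' P)" and "Q' = V - insert v (insert v' Q)"
  have nbrs': "nbrs v = {v', x2, x1}" "nbrs v' = {v, x4, x3}" using nbrs by auto
  \<comment> \<open>The cells of \<open>x3\<close> and \<open>x4\<close> come from
    \<open>separates_Int\<close> with the roles of \<open>v\<close> and \<open>v'\<close>
    exchanged.\<close>
  have sw: "separates v v' A B T = separates v' v A B T" for A B T
    by (simp add: separates_def insert_commute)
  have P': "separates v v' {x2, x4} {x1, x3} P'"
    unfolding P'_def by (rule separates_compl) (use nbrs P in auto)
  have Q': "separates v v' {x2, x3} {x1, x4} Q'"
    unfolding Q'_def by (rule separates_compl[OF nbrs(1) nbrs'(2)]) (rule Q)
  have "P \<inter> Q = {x1}" by (rule separates_Int[OF nbrs]) (use P Q in auto)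
  moreover have "P' \<inter> Q' = {x2}"
    by (rule separates_Int[OF nbrs']) (use P' Q' in \<open>auto simp: insert_commute\<close>)
  moreover have "P \<inter> Q' = {x3}"
    by (rule separates_Int[OF nbrs(2) nbrs(1)]) (use P Q' in \<open>auto simp: insert_commute sw\<close>)
  moreover have "P' \<inter> Q = {x4}"
    by (rule separates_Int[OF nbrs'(2) nbrs'(1)]) (use P' Q in \<open>auto simp: insert_commute sw\<close>)
  moreover have "V = insert v (insert v' (P \<inter> Q \<union> P' \<inter> Q' \<union> P \<inter> Q' \<union> P' \<inter> Q))"
  proof -
    have "v \<in> V" "v' \<in> V" "P \<subseteq> V" "Q \<subseteq> V"
      using nbrs nbrs_subset[of v] nbrs_subset[of v'] P Q by (auto simp: separates_def)
    then show ?thesis unfolding P'_def Q'_def by blast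
  qed
  ultimately show ?thesis by auto
qed

lemma nbrs_disjoint: "u \<in> nbrs v \<Longrightarrow> nbrs u \<inter> nbrs v = {}"
  using no_triangle[of u v] nbrs_sym by blast

lemma convex_comb_both_pairings_separated:
  assumes nbrs: "nbrs v = {v', x1, x2}" "nbrs v' = {v, x3, x4}"
    and P: "separates v v' {x1, x3} {x2, x4} P" and Q: "separates v v' {x1, x4} {x2, x3} Q"
  shows "convex_comb (two_ec_sets V E) E (\<lambda>_. 7 / 9)"
proof -
  have V: "V = {v, x3, x4, v', x1, x2}" by (rule both_pairings_separated[OF assms])
  have inV: "v \<in> V" "v' \<in> V" "x3 \<in> V" "x4 \<in> V" using V by auto
  have d1: "v' \<noteq> x1" "v' \<noteq> x2" "x1 \<noteq> x2" "v \<noteq> x3" "v \<noteq> x4" "x3 \<noteq> x4"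
    using card_nbrs[OF inV(1)] card_nbrs[OF inV(2)] unfolding nbrs by (auto dest!: card_three)
  have d2: "v \<noteq> v'" "v \<noteq> x1" "v \<noteq> x2" "v' \<noteq> x3" "v' \<noteq> x4"
    using not_nbrs_self[of v] not_nbrs_self[of v'] unfolding nbrs by auto
  have "nbrs v' \<inter> nbrs v = {}" by (rule nbrs_disjoint) (simp add: nbrs)
  then have d3: "x1 \<noteq> x3" "x1 \<noteq> x4" "x2 \<noteq> x3" "x2 \<noteq> x4" unfolding nbrs by auto
  have K: "nbrs x = {v', x1, x2}" if x: "x = x3 \<or> x = x4" for x
  proof (rule card_subset_eq)
    \<comment> \<open>Without triangles no neighbour of \<open>x\<close> is in
      \<open>{v, x3, x4}\<close>, which leaves only the other side of the bipartition.\<close>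
    have "nbrs x \<inter> nbrs v' = {}" by (rule nbrs_disjoint) (use x nbrs in auto)
    then show "nbrs x \<subseteq> {v', x1, x2}" using nbrs_subset[of x] nbrs(2) V by auto
    show "card (nbrs x) = card {v', x1, x2}"
      using x card_nbrs[of x] inV d1 by auto
  qed simp
  show ?thesis
    by (rule convex_comb_K33[OF V]) (use d1 d2 d3 K nbrs in auto)
qed

lemma convex_comb_edge_vector:
  assumes nbrs: "nbrs v = {v', x1, x2}" "nbrs v' = {v, x3, x4}"
    and unsep: "\<nexists>T. separates v v' {x1, x3} {x2, x4} T"
    and IH: "\<And>V' E' :: 'a set set. cubic_3ec V' E' \<Longrightarrow> card V' < card V \<Longrightarrow>
      convex_comb (two_ec_sets V' E') E' (\<lambda>_. 7 / 9)"
  shows "convex_comb (two_ec_sets V E) E (edge_vector {v, v'})"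
proof -
  have inV: "v \<in> V" "v' \<in> V" "x1 \<in> V" "x2 \<in> V" "x3 \<in> V" "x4 \<in> V"
    using nbrs nbrs_subset[of v] nbrs_subset[of v'] by auto
  have nv: "v \<in> nbrs x1" "v \<in> nbrs x2" "v' \<in> nbrs x3" "v' \<in> nbrs x4"
    using nbrs nbrs_sym by blast+
  obtain r1 s1 where n1: "nbrs x1 = {v, r1, s1}" using nbrs_obtain[OF inV(3) nv(1)] .
  obtain r2 s2 where n2: "nbrs x2 = {v, r2, s2}" using nbrs_obtain[OF inV(4) nv(2)] .
  obtain r3 s3 where n3: "nbrs x3 = {v', r3, s3}" using nbrs_obtain[OF inV(5) nv(3)] .
  obtain r4 s4 where n4: "nbrs x4 = {v', r4, s4}" using nbrs_obtain[OF inV(6) nv(4)] .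
  \<comment> \<open>The other half of the same pairing is admissible as well, by
    complementing.\<close>
  have unsep': "\<nexists>T. separates v v' {x2, x4} {x1, x3} T"
  proof
    assume "\<exists>T. separates v v' {x2, x4} {x1, x3} T"
    then obtain T where "separates v v' {x2, x4} {x1, x3} T" ..
    then have "separates v v' {x1, x3} {x2, x4} (V - insert v (insert v' T))"
      by (intro separates_compl) (use nbrs in auto)
    then show False using unsep by blast
  qed
  interpret A: good_config V E v v' x1 x2 x3 x4 r1 s1 r3 s3
    by unfold_locales
       (use nbrs n1 n3 unsep in \<open>auto simp: separates_def not_le[symmetric]\<close>)
  interpret B: good_config V E v v' x2 x1 x4 x3 r2 s2 r4 s4
    by unfold_locales
       (use nbrs n2 n4 unsep' in \<open>auto simp: separates_def not_le[symmetric]\<close>)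
  have "convex_comb (two_ec_sets V E) E (\<lambda>h. (1 - 1/2) * A.reduction_vector h + 1/2 * B.reduction_vector h)"
    by (intro convex_comb_mix A.convex_comb_reduction B.convex_comb_reduction IH
        A.cubic_3ec_reduced B.cubic_3ec_reduced A.card_V0 B.card_V0) auto
  then show ?thesis
  proof (rule convex_comb_cong)
    fix h assume h: "h \<in> E"
    obtain a b where ab: "h = {a, b}" "a \<noteq> b" using h by (rule edge_cases)
    note d = A.dist'
    have ind: "neighbour_ind {v, v'} x = of_bool (x = x1 \<or> x = x2 \<or> x = x3 \<or> x = x4)" for x
    proof -
      have "nbrs x \<inter> {v, v'} \<noteq> {} \<longleftrightarrow> x \<in> nbrs v \<or> x \<in> nbrs v'" using nbrs_sym by blast
      then show ?thesis unfolding neighbour_ind_def nbrs using d by auto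
    qed
    have sum: "(\<Sum>x\<in>h. neighbour_ind {v, v'} x) = neighbour_ind {v, v'} a + neighbour_ind {v, v'} b"
      using ab by simp
    \<comment> \<open>An edge joining both \<open>x_i\<close> of one half would be raised to 1 by
      one reduction only, whereas \<open>edge_vector\<close> counts both of its ends.\<close>
    have adj: "\<not> (x1 \<in> h \<and> x3 \<in> h)" "\<not> (x2 \<in> h \<and> x4 \<in> h)"
    proof -
      show "\<not> (x1 \<in> h \<and> x3 \<in> h)"
        using A.x1_x3_nonadjacent d h ab unfolding nbrs_iff by (auto simp: insert_commute)
      show "\<not> (x2 \<in> h \<and> x4 \<in> h)"
        using A.x2_x4_nonadjacent d h ab by (auto simp: insert_commute)
    qed
    consider "h = {v, v'}" | x where "h = {v, x}" "x = x1 \<or> x = x2" | x where "h = {v', x}" "x = x3 \<or> x = x4"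
      | "v \<notin> h" "v' \<notin> h"
    proof -
      have *: "\<exists>u\<in>nbrs c. h = {c, u}" if "c \<in> h" for c
      proof -
        have "h \<in> {e \<in> E. c \<in> e}" using that h by simp
        then show ?thesis unfolding star_eq by blast
      qed
      show thesis
        using *[of v] *[of v'] that unfolding nbrs by (auto simp: insert_commute)
    qed
    then show "(1 - 1/2) * A.reduction_vector h + 1/2 * B.reduction_vector h = edge_vector {v, v'} h"
    proof cases
      case 1
      then show ?thesis
        unfolding edge_vector_def A.reduction_vector_def B.reduction_vector_def
        using d by (simp add: ind doubleton_eq_iff)
    next
      case 2
      \<comment> \<open>One reduction deletes \<open>h\<close> and the other keeps it: 1/2 = 7/9 -
        7/18 + 1/9.\<close>
      have "card ({v, v'} \<inter> {v, x}) = 1" using 2 d by (auto simp: crosses_pair)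
      then show ?thesis
        unfolding edge_vector_def A.reduction_vector_def B.reduction_vector_def 2(1)
        using 2(2) by (elim disjE; simp add: ind doubleton_eq_iff d)
    next
      case 3
      have "card ({v, v'} \<inter> {v', x}) = 1" using 3 d by (auto simp: crosses_pair)
      then show ?thesis
        unfolding edge_vector_def A.reduction_vector_def B.reduction_vector_def 3(1)
        using 3(2) by (elim disjE; simp add: ind doubleton_eq_iff d)
    next
      case 4
      have "{v, v'} \<inter> h = {}" using 4 by auto
      moreover have "h \<noteq> {v, v'}" "h \<noteq> {v, x1}" "h \<noteq> {v, x2}" "h \<noteq> {v', x3}" "h \<noteq> {v', x4}"
        using 4 by auto
      moreover have "neighbour_ind {v, v'} a + neighbour_ind {v, v'} b
          = of_bool (x1 \<in> h \<or> x3 \<in> h) + of_bool (x2 \<in> h \<or> x4 \<in> h)"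
      proof -
        consider "a = x1" | "a = x2" | "a = x3" | "a = x4" | "a \<notin> {x1, x2, x3, x4}" by blast
        then show ?thesis
          by cases (use adj ab(2) in \<open>auto simp: ab(1) ind d\<close>)
      qed
      ultimately show ?thesis
        unfolding edge_vector_def A.reduction_vector_def B.reduction_vector_def sum
        using 4 by (cases "x1 \<in> h \<or> x3 \<in> h"; cases "x2 \<in> h \<or> x4 \<in> h"; simp)
    qed
  qed
qed

text \<open>An edge with both pairings separated yields the goal itself rather than its
  \<open>edge_vector\<close>; arguing by contradiction allows this case to be discarded within the
  claim about all edges.\<close>

lemma convex_comb_essential:
  assumes IH: "\<And>V' E' :: 'a set set. cubic_3ec V' E' \<Longrightarrow> card V' < card V \<Longrightarrow>
      convex_comb (two_ec_sets V' E') E' (\<lambda>_. 7 / 9)"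
  shows "convex_comb (two_ec_sets V E) E (\<lambda>_. 7 / 9)"
proof (rule ccontr)
  assume neg: "\<not> ?thesis"
  have "convex_comb (two_ec_sets V E) E (edge_vector e)" if e: "e \<in> E" for e
  proof -
    obtain v v' where vv: "e = {v, v'}" "v \<in> V" "v' \<in> V" using e by (rule edge_cases)
    then have "v' \<in> nbrs v" "v \<in> nbrs v'" using e by (auto simp: nbrs_iff insert_commute)
    obtain x1 x2 where n1: "nbrs v = {v', x1, x2}" using nbrs_obtain[OF vv(2) \<open>v' \<in> nbrs v\<close>] .
    obtain x3 x4 where n2: "nbrs v' = {v, x3, x4}" using nbrs_obtain[OF vv(3) \<open>v \<in> nbrs v'\<close>] .
    have n2': "nbrs v' = {v, x4, x3}" using n2 by auto
    have "(\<nexists>P. separates v v' {x1, x3} {x2, x4} P) \<or> (\<nexists>Q. separates v v' {x1, x4} {x2, x3} Q)"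
      using convex_comb_both_pairings_separated[OF n1 n2] neg by blast
    then show ?thesis
      using convex_comb_edge_vector[OF n1 n2 _ IH] convex_comb_edge_vector[OF n1 n2' _ IH]
      unfolding vv(1) by blast
  qed
  moreover have "E \<noteq> {}"
  proof
    assume "E = {}"
    moreover obtain u where "u \<in> V" using large by fastforce
    ultimately show False using deg3[of u] by simp
  qed
  ultimately show False using convex_comb_average neg by blast
qed

end

section \<open>The induction on the number of vertices and the translation to graphs\<close>

lemma convex_comb_cubic_3ec:
  "cubic_3ec V E \<Longrightarrow> convex_comb (two_ec_sets V E) E (\<lambda>_. 7 / 9)"
proof (induction "card V" arbitrary: V E rule: less_induct)
  case less
  interpret cubic_3ec V E by (rule less.prems)
  consider "V = {}" | "card V = 4"
    | S where "S \<subseteq> V" "cutsize E S = 3" "card S \<noteq> 1" "card (V - S) \<noteq> 1"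
    | "4 < card V" "\<And>A. A \<subseteq> V \<Longrightarrow> cutsize E A = 3 \<Longrightarrow> card A = 1 \<or> card (V - A) = 1"
  proof -
    have "4 \<le> card V" if "V \<noteq> {}"
    proof -
      obtain u where u: "u \<in> V" using \<open>V \<noteq> {}\<close> by blast
      have "card (insert u (nbrs u)) = 4" using card_nbrs[OF u] not_nbrs_self finite_nbrs by simp
      moreover have "card (insert u (nbrs u)) \<le> card V"
        by (rule card_mono) (use u nbrs_subset finite_V in auto)
      ultimately show ?thesis by simp
    qed
    then show thesis using that by (metis le_neq_implies_less)
  qed
  then show ?case
  proof cases
    case 1
    then have "E = {}" using edge by fastforce
    then show ?thesis
      using convex_comb_single[OF finite_two_ec_sets[OF finite_E] E_in_two_ec_sets, of E]
      by (auto intro: convex_comb_cong)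
  next
    case 2
    then show ?thesis by (rule convex_comb_K4)
  next
    case 3
    have half: "convex_comb (half E T) {e \<in> E. e \<inter> T \<noteq> {}} (\<lambda>_. 7 / 9)"
      if T: "T \<subseteq> V" "cutsize E T = 3" "card T \<noteq> 1" "card (V - T) \<noteq> 1" for T
    proof -
      have "T \<noteq> V" using T(2) by auto
      \<comment> \<open>The contracted complement is represented by one of its own vertices. As it
        has others, the contracted graph lives on a proper subset of \<open>V\<close>.\<close>
      then obtain z where z: "z \<in> V" "z \<notin> T" using T(1) by blast
      have "insert z T \<noteq> V"
      proof
        assume "insert z T = V"
        then have "V - T = {z}" using z by auto
        then show False using T(4) by simp
      qed
      then have "card (insert z T) < card V"
        using z T(1) by (intro psubset_card_mono finite_V) auto
      moreover obtain E1 where "cubic_3ec (insert z T) E1"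
        "convex_comb (two_ec_sets (insert z T) E1) E1 (\<lambda>_. 7 / 9) \<longrightarrow>
          convex_comb (half E T) {e \<in> E. e \<inter> T \<noteq> {}} (\<lambda>_. 7 / 9)"
        using contract[OF T(1,2,3) z(2)] by blast
      ultimately show ?thesis using less.hyps by blast
    qed
    have "convex_comb (half E (V - S)) {e \<in> E. e \<inter> (V - S) \<noteq> {}} (\<lambda>_. 7 / 9)"
      by (rule half) (use 3 cutsize_E_compl in \<open>auto simp: double_diff\<close>)
    then show ?thesis using glue[OF 3(1,2) half[OF 3]] by blast
  next
    case 4
    interpret essential V E by unfold_locales (use 4 in auto)
    show ?thesis by (rule convex_comb_essential) (use less.hyps in blast)
  qed
qed

theorem theorem1:
  fixes G :: "'a ugraph" and y :: "'a set \<Rightarrow> real"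
  assumes "simple_graph G"
    and "cubic G"
    and "edge_connected 3 G"
    and "\<And>e. e \<in> edges G \<Longrightarrow> y e = 7 / 9"
  shows "\<exists>(k::nat) (H :: nat \<Rightarrow> 'a ugraph) (c :: nat \<Rightarrow> real).
           k > 0 \<and>
           (\<forall>i\<in>{1..k}. spanning_subgraph (H i) G \<and> edge_connected 2 (H i)) \<and>
           (\<forall>i\<in>{1..k}. c i \<ge> 0) \<and>
           (\<Sum>i=1..k. c i) = 1 \<and>
           (\<forall>e\<in>edges G. y e = (\<Sum>i=1..k. c i * incidence_vector (H i) e))"
proof -
  obtain V E where G: "G = (V, E)" by (cases G)
  have edge: "e \<subseteq> V \<and> card e = 2" if "e \<in> E" for e
    using assms(1) that by (auto simp: simple_graph_def G)
  interpret cubic_3ec V E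
  proof
    show "finite V" using assms(1) by (simp add: simple_graph_def G)
    show "cutsize E {v} = 3" if "v \<in> V" for v
      using assms(2) that by (simp add: cubic_def degree_def G cutsize_singleton)
    show "3 \<le> cutsize E A" if "A \<subseteq> V" "A \<noteq> {}" "A \<noteq> V" for A
      using assms(3) that by (simp add: edge_connected_def cut_def cutsize_def G)
  qed (use edge in auto)
  let ?S = "two_ec_sets V E"
  have fin: "finite ?S" by (rule finite_two_ec_sets[OF finite_E])
  obtain w where w: "\<And>F. F \<in> ?S \<Longrightarrow> 0 \<le> w F" "(\<Sum>F\<in>?S. w F) = 1"
    "\<And>e. e \<in> E \<Longrightarrow> (\<Sum>F\<in>?S. w F * of_bool (e \<in> F)) = (7 / 9 :: real)"
    using convex_comb_cubic_3ec[OF cubic_3ec_axioms] unfolding convex_comb_def by blast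
  \<comment> \<open>All 2-edge-connected spanning edge sets are numbered, including those of weight
    0, so \<open>k\<close> is the size of the whole family; it is positive because \<open>E\<close>
    belongs to it.\<close>
  obtain F where F: "bij_betw F {1..card ?S} ?S"
    using ex_bij_betw_nat_finite_1[OF fin] by blast
  have FS: "F i \<in> ?S" if "i \<in> {1..card ?S}" for i using F that by (rule bij_betwE[THEN bspec])
  have reindex: "(\<Sum>i=1..card ?S. g (F i)) = (\<Sum>D\<in>?S. g D)" for g :: "_ \<Rightarrow> real"
    by (rule sum.reindex_bij_betw[OF F])
  show ?thesis
  proof (intro exI conjI ballI)
    show "card ?S > 0" using fin E_in_two_ec_sets by (auto simp: card_gt_0_iff)
    fix i assume i: "i \<in> {1..card ?S}"
    show "spanning_subgraph (V, F i) G"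
      using FS[OF i] edge
      by (auto simp: spanning_subgraph_def is_subgraph_def G two_ec_sets_def)
    show "edge_connected 2 (V, F i)"
      using FS[OF i]
      by (simp add: edge_connected_def cut_def two_ec_sets_def two_ec_def cutsize_def)
    show "0 \<le> w (F i)" using w(1) FS[OF i] .
  next
    show "(\<Sum>i=1..card ?S. w (F i)) = 1" using reindex[of w] w(2) by simp
  next
    fix e assume e: "e \<in> edges G"
    then have "e \<in> E" by (simp add: G)
    have "y e = 7 / 9" using e by (rule assms(4))
    also have "\<dots> = (\<Sum>D\<in>?S. w D * of_bool (e \<in> D))" by (rule w(3)[OF \<open>e \<in> E\<close>, symmetric])
    also have "\<dots> = (\<Sum>i=1..card ?S. w (F i) * of_bool (e \<in> F i))" by (rule reindex[symmetric])
    finally show "y e = (\<Sum>i=1..card ?S. w (F i) * incidence_vector (V, F i) e)"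
      by (simp only: incidence_vector_def indicator_def snd_conv)
  qed
qed

end
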